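(* Let $d\ge 1$, let $s\in\mathbb R^d$ be a vector with positive entries, and let $*:\mathbb R^d\times\mathbb R^d\to\mathbb R^d$ be a bilinear map with nonnegative coefficients. Let $g(n)$ and $\lambda=\lim_{n\to\infty}\sqrt[n]{g(n)}$ be the associated growth function and growth rate. Then there are nonnegative real numbers $r,r'$ and positive real numbers $a,a'$ such that for every integer $n\ge 1$, \[ a\, n^{-r}\lambda^n\le g(n)\le a'\, n^{r'}\lambda^n . \]
   Context: The map $*$ has the form $(x*y)_k=\sum_{i,j}c^{(k)}_{i,j}x_iy_j$ with all $c^{(k)}_{i,j}\ge 0$, where $x_i$ denotes the $i$-th entry of a vector $x$. Define $A_1=\{s\}$ and, for $n\ge 2$, $A_n=\bigcup_{1\le m\le n-1}\{x*y: x\in A_m,\ y\in A_{n-m}\}$. Define $g(n)=\max\{v_i: v\in A_n,\ 1\le i\le d\}$. It is known that the limit $\lambda=\lim_{n\to\infty}\sqrt[n]{g(n)}$ exists for positive $s$ and nonnegative coefficients; it is called the growth rate.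
   Formalization: The formal theorem assumes additionally that λ > 0; when λ = 0 (for example when all coefficients are zero) the stated upper bound always fails at n = 1, since g(1) = max s_i > 0. *)

theory Defs
  imports "HOL-Analysis.Analysis"
begin

fun products :: "('v \<Rightarrow> 'v \<Rightarrow> 'v) \<Rightarrow> 'v \<Rightarrow> nat \<Rightarrow> 'v set" where
  "products f s n =
     (if n = 0 then {}
      else if n = 1 then {s}
      else (\<Union>m\<in>{1..n-1}. {f x y |x y. x \<in> products f s m \<and> y \<in> products f s (n - m)}))"

declare products.simps [simp del]

definition growth :: "(real^'d \<Rightarrow> real^'d \<Rightarrow> real^'d) \<Rightarrow> real^'d \<Rightarrow> nat \<Rightarrow> real" where
  "growth f s n = Max {v $ i |v i. v \<in> products f s n}"

text \<open>For \<open>n \<ge> 1\<close> the maximum is taken over a finite nonempty set; \<open>growth f s 0\<close> is unspecified.\<close>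

lemma finite_products: "finite (products f s n)"
proof (induction n rule: less_induct)
  case (less n)
  have "finite {f x y |x y. x \<in> products f s m \<and> y \<in> products f s (n - m)}"
    if "m \<in> {1..n-1}" for m
    using that less[of m] less[of "n - m"]
    by (intro finite_image_set2) auto
  then show ?case
    by (subst products.simps) auto
qed

lemma products_nonempty: "n \<ge> 1 \<Longrightarrow> products f s n \<noteq> {}"
proof (induction n rule: less_induct)
  case (less n)
  show ?case
  proof (cases "n = 1")
    case True
    then show ?thesis by (simp add: products.simps)
  next
    case False
    with less.prems have "products f s 1 \<noteq> {}" "products f s (n - 1) \<noteq> {}"
      using less.IH[of 1] less.IH[of "n - 1"] by simp_all
    then obtain x y where "x \<in> products f s 1" "y \<in> products f s (n - 1)"
      by blast
    with False less.prems have "f x y \<in> products f s n"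
      by (subst products.simps) (simp, intro bexI[of _ 1], auto)
    then show ?thesis by blast
  qed
qed

lemma finite_growth_set: "finite {v $ i |v i. v \<in> products f s n}"
  for f :: "real^'d \<Rightarrow> real^'d \<Rightarrow> real^'d"
proof -
  have "{v $ i |v i. v \<in> products f s n} = (\<Union>v\<in>products f s n. range (($) v))"
    by auto
  then show ?thesis by (simp add: finite_products)
qed

lemma growth_set_nonempty: "n \<ge> 1 \<Longrightarrow> {v $ i |v i. v \<in> products f s n} \<noteq> {}"
  for f :: "real^'d \<Rightarrow> real^'d \<Rightarrow> real^'d"
  using products_nonempty[of n f s] by auto

end

theory Submission
  imports Defs
begin

text \<open>
  A product of \<open>n\<close> copies of \<open>s\<close> is a binary tree with \<open>n\<close> leaves. Removing a subtree leaves a tree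
  with a hole, through which the value of the whole depends linearly on the value of the subtree; let
  \<open>M\<close> be the nonnegative matrix of this linear map and \<open>m\<close> the number of remaining leaves.
  Write \<open>i \<rightarrow> j\<close> if some such matrix has a positive entry at \<open>(i, j)\<close>. This is a preorder, and
  its equivalence classes split the coordinates. Filling a hole with another tree with a hole
  multiplies the matrices, and iterating one tree gives \<open>M $ i $ i \<le> lam ^ m\<close>
  (\<open>diag_le_rate_power\<close>). Hence all entries of \<open>M\<close> inside one class are \<open>O(lam ^ m)\<close>, without any
  polynomial factor.

  Upper bound (\<open>entries_le_polynomial_times_exponential\<close>). Let \<open>K\<close> be the class of \<open>k\<close>. Expanding the
  \<open>k\<close>-th entry of a product along paths whose coordinates stay in \<open>K\<close>, each path ends at a node of
  the tree whose two factors both contribute coordinates strictly below \<open>K\<close>, or at a leaf. There are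
  fewer than \<open>2 * n\<close> nodes; for each of them the path costs \<open>O(lam ^ m)\<close>, and what is below is a
  polynomial times an exponential by induction. So each class adds to the degree of the polynomial,
  and there are finitely many classes.

  Lower bound. The same estimate with a smaller base shows that some class is critical: the entries
  of its matrices grow at no rate below \<open>lam\<close> (\<open>minimal_critical\<close>). Take a critical class \<open>K\<close> that is
  minimal, so that every coordinate strictly below \<open>K\<close> is exponentially smaller than \<open>lam ^ n\<close>.
  The heart is \<open>large_pieces\<close>: for all large \<open>\<tau>\<close> there is a tree with a hole, with between \<open>\<tau>\<close> and
  \<open>8 * \<tau>\<close> leaves, that has an entry inside \<open>K\<close> of size at least \<open>\<epsilon> * lam ^ m\<close>, where \<open>\<epsilon> > 0\<close> does not
  depend on \<open>\<tau>\<close>. Otherwise every large tree could be cut into pieces with at least \<open>\<tau>\<close> leaves and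
  small entries, the entries of products of pieces would shrink below \<open>lam ^ m\<close> by a factor
  exponential in \<open>m\<close>, and \<open>K\<close> would not be critical. Now build a product of exactly \<open>n\<close> factors greedily: put
  a piece that has at least a fixed fraction of the \<open>n\<close> leaves on top, join it by a tree of bounded
  size, and continue with the remaining leaves (\<open>K_entries_ge\<close>). After \<open>O(log n)\<close> pieces only a
  bounded number of leaves remains. Each piece loses a constant factor, and together they lose a
  power of \<open>n\<close>.
\<close>

section \<open>Uniform bounds\<close>

lemma finite_uniform_bound:
  fixes P :: "'b \<Rightarrow> 'c::linorder \<Rightarrow> bool"
  assumes "finite S" and "\<And>i. i \<in> S \<Longrightarrow> \<exists>C. P i C"
    and "\<And>i C D. P i C \<Longrightarrow> C \<le> D \<Longrightarrow> P i D"
  shows "\<exists>C\<ge>C0. \<forall>i\<in>S. P i C"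
proof -
  obtain g where g: "\<And>i. i \<in> S \<Longrightarrow> P i (g i)" using assms(2) by metis
  let ?C = "Max (insert C0 (g ` S))"
  have "C0 \<le> ?C" and "\<And>i. i \<in> S \<Longrightarrow> g i \<le> ?C" using assms(1) by auto
  with g assms(3) show ?thesis by blast
qed

lemma polynomial_le_exponential:
  fixes \<mu> \<nu> :: real
  assumes "0 < \<mu>" "\<mu> < \<nu>"
  shows "\<exists>C>0. \<forall>n. real n ^ r * \<mu> ^ n \<le> C * \<nu> ^ n"
proof -
  have bounded: "\<exists>C>0. \<forall>n. real n ^ r * x ^ n \<le> C" if "0 < x" "x < 1" for x :: real
    using that
  proof (induction r arbitrary: x)
    case 0
    then show ?case by (intro exI[of _ 1]) (auto intro: power_le_one)
  next
    case (Suc r)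
    have s: "0 < sqrt x" "sqrt x < 1" using Suc.prems by auto
    then obtain C where C: "C > 0" "\<And>n. real n ^ r * sqrt x ^ n \<le> C" using Suc.IH by blast
    have "(\<lambda>n. real n * sqrt x ^ n) \<longlonglongrightarrow> 0"
      using s powser_times_n_limit_0[of "sqrt x"] by simp
    then have "Bseq (\<lambda>n. real n * sqrt x ^ n)"
      by (intro convergent_imp_Bseq convergentI)
    then obtain B where B: "B > 0" "\<And>n. \<bar>real n * sqrt x ^ n\<bar> \<le> B"
      by (auto elim!: BseqE)
    have "real n ^ Suc r * x ^ n \<le> C * B" for n
    proof -
      have "x ^ n = sqrt x ^ n * sqrt x ^ n"
        using Suc.prems by (simp flip: power_mult_distrib)
      then have "real n ^ Suc r * x ^ n = (real n ^ r * sqrt x ^ n) * (real n * sqrt x ^ n)" by simp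
      also have "\<dots> \<le> C * B"
        using C B(1) B(2)[of n] s by (intro mult_mono) auto
      finally show ?thesis .
    qed
    with C(1) B(1) show ?case by (intro exI[of _ "C * B"]) auto
  qed
  from bounded[of "\<mu> / \<nu>"] assms obtain C where "C > 0" "\<And>n. real n ^ r * (\<mu> / \<nu>) ^ n \<le> C" by auto
  with assms show ?thesis by (intro exI[of _ C]) (auto simp: field_simps power_divide)
qed

section \<open>Products with one hole\<close>

locale nonneg_bilinear =
  fixes s :: "real^'d"
    and c :: "'d \<Rightarrow> 'd \<Rightarrow> 'd \<Rightarrow> real"
    and f :: "real^'d \<Rightarrow> real^'d \<Rightarrow> real^'d"
  assumes s_pos: "\<And>i. s $ i > 0"
    and f_bilinear: "\<And>x y k. f x y $ k = (\<Sum>i\<in>UNIV. \<Sum>j\<in>UNIV. c k i j * x $ i * y $ j)"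
    and c_nonneg: "\<And>k i j. c k i j \<ge> 0"
begin

abbreviation A :: "nat \<Rightarrow> (real^'d) set" where
  "A n \<equiv> products f s n"

lemma A_0 [simp]: "A 0 = {}"
  by (simp add: products.simps)

lemma A_1: "A 1 = {s}" "A (Suc 0) = {s}"
  by (simp_all add: products.simps)

lemma A_pos: "v \<in> A n \<Longrightarrow> n \<ge> 1"
  by (cases n) auto

lemma A_mult:
  assumes "x \<in> A m" "y \<in> A n"
  shows "f x y \<in> A (m + n)"
proof -
  have "m \<ge> 1" "n \<ge> 1" using assms A_pos by blast+
  then have "m \<in> {1..m + n - 1}" "m + n \<noteq> 0" "m + n \<noteq> 1" by auto
  moreover have "f x y \<in> {f x y |x y. x \<in> A m \<and> y \<in> A (m + n - m)}"
    using assms by auto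
  ultimately show ?thesis
    by (subst products.simps) (simp only: if_False, blast)
qed

lemma A_induct [consumes 1, case_names base mult]:
  assumes "v \<in> A n"
    and base: "P 1 s"
    and mult: "\<And>m x n y. x \<in> A m \<Longrightarrow> y \<in> A n \<Longrightarrow> P m x \<Longrightarrow> P n y \<Longrightarrow> P (m + n) (f x y)"
  shows "P n v"
  using assms(1)
proof (induction n arbitrary: v rule: less_induct)
  case (less n)
  show ?case
  proof (cases "n = 1")
    case True
    with less.prems base show ?thesis by (simp add: A_1)
  next
    case False
    with less.prems A_pos[OF less.prems] obtain m x y where
      m: "1 \<le> m" "m \<le> n - 1" and xy: "x \<in> A m" "y \<in> A (n - m)" "v = f x y"
      by (subst (asm) products.simps) auto
    from m have "m < n" "n - m < n" by auto
    with less.IH xy have "P m x" "P (n - m) y" by auto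
    from mult[OF xy(1,2) this] m xy(3) show ?thesis by simp
  qed
qed

lemma A_nonneg: "v \<in> A n \<Longrightarrow> v $ i \<ge> 0"
proof (induction arbitrary: i rule: A_induct)
  case base
  show ?case using s_pos[of i] by simp
next
  case (mult m x n y)
  then show ?case
    by (auto simp: f_bilinear intro!: sum_nonneg mult_nonneg_nonneg c_nonneg)
qed

definition left_mult :: "real^'d \<Rightarrow> real^'d^'d" where
  "left_mult x = (\<chi> k j. \<Sum>i\<in>UNIV. c k i j * x $ i)"

definition right_mult :: "real^'d \<Rightarrow> real^'d^'d" where
  "right_mult y = (\<chi> k i. \<Sum>j\<in>UNIV. c k i j * y $ j)"

lemma left_mult_apply: "left_mult x *v y = f x y"
proof -
  have "(\<Sum>j\<in>UNIV. (\<Sum>i\<in>UNIV. c k i j * x $ i) * y $ j)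
      = (\<Sum>i\<in>UNIV. \<Sum>j\<in>UNIV. c k i j * x $ i * y $ j)" for k
    unfolding sum_distrib_right by (rule sum.swap)
  then show ?thesis
    by (simp add: vec_eq_iff matrix_vector_mult_def left_mult_def f_bilinear)
qed

lemma right_mult_apply: "right_mult y *v x = f x y"
  by (simp add: vec_eq_iff matrix_vector_mult_def right_mult_def f_bilinear
      sum_distrib_right mult.assoc) (simp add: mult_ac)

text \<open>
  \<open>one_hole m M\<close> says that \<open>M\<close> describes how a product of \<open>m\<close> copies of \<open>s\<close> and one unknown vector
  depends on that vector. The tree is generated along the path from the root to the hole;
  \<open>one_step l X\<close> is one node of this path, where a product of \<open>l\<close> copies of \<open>s\<close> hangs off.
\<close>
inductive one_step :: "nat \<Rightarrow> real^'d^'d \<Rightarrow> bool" where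
  left: "x \<in> A l \<Longrightarrow> one_step l (left_mult x)"
| right: "x \<in> A l \<Longrightarrow> one_step l (right_mult x)"

inductive one_hole :: "nat \<Rightarrow> real^'d^'d \<Rightarrow> bool" where
  hole: "one_hole 0 (mat 1)"
| step: "one_hole m M \<Longrightarrow> one_step l X \<Longrightarrow> one_hole (m + l) (M ** X)"

lemma one_step_hole: "one_step l X \<Longrightarrow> one_hole l X"
  using one_hole.step[OF one_hole.hole] by fastforce

lemma one_hole_mult:
  assumes "one_hole m M" "one_hole n N"
  shows "one_hole (m + n) (M ** N)"
  using assms(2)
proof (induction rule: one_hole.induct)
  case hole
  show ?case using assms(1) by simp
next
  case (step n N l X)
  from one_hole.step[OF step.IH step.hyps(2)] show ?case
    by (simp add: matrix_mul_assoc add.assoc)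
qed

lemma one_step_apply: "one_step l X \<Longrightarrow> v \<in> A n \<Longrightarrow> X *v v \<in> A (l + n)"
  using A_mult[of _ l v n] A_mult[of v n _ l]
  by (auto elim!: one_step.cases simp: left_mult_apply right_mult_apply add.commute)

lemma one_hole_apply: "one_hole m M \<Longrightarrow> v \<in> A n \<Longrightarrow> M *v v \<in> A (m + n)"
proof (induction arbitrary: v n rule: one_hole.induct)
  case (step m M l X)
  from step.IH[OF one_step_apply[OF step.hyps(2) step.prems]]
  show ?case by (simp add: matrix_vector_mul_assoc add.assoc)
qed simp

lemma one_step_nonneg: "one_step l X \<Longrightarrow> X $ i $ j \<ge> 0"
  by (erule one_step.cases)
    (auto simp: left_mult_def right_mult_def intro!: sum_nonneg mult_nonneg_nonneg c_nonneg A_nonneg)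

lemma one_step_pos: "one_step l X \<Longrightarrow> l \<ge> 1"
  by (auto elim!: one_step.cases dest: A_pos)

lemma one_hole_nonneg: "one_hole m M \<Longrightarrow> M $ i $ j \<ge> 0"
proof (induction arbitrary: i j rule: one_hole.induct)
  case hole
  show ?case by (simp add: mat_def)
next
  case (step m M l X)
  then show ?case
    by (simp add: matrix_matrix_mult_def sum_nonneg one_step_nonneg)
qed

lemma mult_entry_ge:
  assumes "one_hole m M" "one_hole n N"
  shows "M $ i $ j * N $ j $ k \<le> (M ** N) $ i $ k"
  unfolding matrix_matrix_mult_def using assms
  by (auto intro!: member_le_sum mult_nonneg_nonneg one_hole_nonneg)

lemma apply_entry_ge:
  assumes "one_hole m M" "v \<in> A n"
  shows "M $ i $ j * v $ j \<le> (M *v v) $ i"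
  unfolding matrix_vector_mult_def using assms
  using member_le_sum[of j UNIV "\<lambda>j. M $ i $ j * v $ j"]
  by (simp add: one_hole_nonneg[OF assms(1)] A_nonneg[OF assms(2)])

lemma A_le_growth: "v \<in> A n \<Longrightarrow> v $ i \<le> growth f s n"
  unfolding growth_def by (intro Max_ge finite_growth_set) auto

lemma growth_attained:
  assumes "n \<ge> 1"
  obtains v i where "v \<in> A n" "growth f s n = v $ i"
  using Max_in[OF finite_growth_set growth_set_nonempty[OF assms], of f s]
  unfolding growth_def by auto

lemma growth_nonneg: "n \<ge> 1 \<Longrightarrow> growth f s n \<ge> 0"
  by (metis growth_attained A_nonneg)

subsection \<open>Reachability\<close>

text \<open>
  The preorder of coordinates: \<open>reach i j\<close> if the entry \<open>i\<close> of some product depends on the entry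
  \<open>j\<close> of one of its subtrees. Its equivalence classes play the part of the irreducible blocks of a
  nonnegative matrix.
\<close>
definition reach :: "'d \<Rightarrow> 'd \<Rightarrow> bool" where
  "reach i j \<longleftrightarrow> (\<exists>m M. one_hole m M \<and> M $ i $ j > 0)"

lemma reachI: "one_hole m M \<Longrightarrow> M $ i $ j \<noteq> 0 \<Longrightarrow> reach i j"
  unfolding reach_def using one_hole_nonneg[of m M i j] by (metis less_le)

lemma reach_refl [simp]: "reach i i"
  by (rule reachI[OF one_hole.hole]) (simp add: mat_def)

lemma reach_trans: "reach i j \<Longrightarrow> reach j k \<Longrightarrow> reach i k"
  unfolding reach_def
  by (meson one_hole_mult mult_entry_ge mult_pos_pos less_le_trans)

lemma right_mult_entry_ge:
  assumes "y \<in> A n"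
  shows "c k i j * y $ j \<le> right_mult y $ k $ i"
  unfolding right_mult_def using assms
  by (auto intro!: member_le_sum[of j UNIV "\<lambda>j. c k i j * y $ j"] mult_nonneg_nonneg c_nonneg A_nonneg)

lemma left_mult_entry_ge:
  assumes "x \<in> A n"
  shows "c k i j * x $ i \<le> left_mult x $ k $ j"
  unfolding left_mult_def using assms
  by (auto intro!: member_le_sum[of i UNIV "\<lambda>i. c k i j * x $ i"] mult_nonneg_nonneg c_nonneg A_nonneg)

lemma s_mem: "s \<in> A 1"
  by (simp add: A_1)

text \<open>
  Since \<open>s\<close> is positive, every nonzero coefficient is seen by multiplication with \<open>s\<close> itself.
\<close>
lemma reach_coeff:
  assumes "c k i j \<noteq> 0"
  shows "reach k i" "reach k j"
proof -
  have c: "c k i j > 0" using assms c_nonneg[of k i j] by simp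
  show "reach k i"
    using right_mult_entry_ge[OF s_mem, of k i j] mult_pos_pos[OF c s_pos[of j]]
    by (intro reachI[OF one_step_hole[OF one_step.right[OF s_mem]]]) auto
  show "reach k j"
    using left_mult_entry_ge[OF s_mem, of k i j] mult_pos_pos[OF c s_pos[of i]]
    by (intro reachI[OF one_step_hole[OF one_step.left[OF s_mem]]]) auto
qed

definition coeff_sum :: real where
  "coeff_sum = (\<Sum>k\<in>UNIV. \<Sum>i\<in>UNIV. \<Sum>j\<in>UNIV. c k i j)"

lemma coeff_sum_nonneg: "coeff_sum \<ge> 0"
  unfolding coeff_sum_def by (intro sum_nonneg c_nonneg)

lemma coeff_le: "c k i j \<le> coeff_sum"
proof -
  have "c k i j \<le> (\<Sum>j\<in>UNIV. c k i j)"
    by (rule member_le_sum) (auto intro: c_nonneg)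
  also have "\<dots> \<le> (\<Sum>i\<in>UNIV. \<Sum>j\<in>UNIV. c k i j)"
    by (rule member_le_sum[of i UNIV "\<lambda>i. \<Sum>j\<in>UNIV. c k i j"]) (auto intro!: sum_nonneg c_nonneg)
  also have "\<dots> \<le> coeff_sum" unfolding coeff_sum_def
    by (rule member_le_sum[of k UNIV "\<lambda>k. \<Sum>i\<in>UNIV. \<Sum>j\<in>UNIV. c k i j"]) (auto intro!: sum_nonneg c_nonneg)
  finally show ?thesis .
qed

subsection \<open>Cutting\<close>

text \<open>
  A path can be cut where the number of leaves above reaches \<open>\<tau>\<close>. The node \<open>X\<close> at which this happens
  is kept apart, because the product that hangs off there may be arbitrarily large.
\<close>
lemma one_hole_cut:
  assumes "one_hole m M" "\<tau> \<ge> 1" "m \<ge> \<tau>"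
  obtains p P l X q Q where "one_hole p P" "one_step l X" "one_hole q Q"
    "M = P ** X ** Q" "m = p + l + q" "p < \<tau>" "p + l \<ge> \<tau>"
  using assms
proof (induction arbitrary: thesis rule: one_hole.induct)
  case hole
  then show ?case by simp
next
  case (step m M l X)
  show ?case
  proof (cases "m \<ge> \<tau>")
    case True
    with step.prems step.IH obtain p P l' X' q Q where *: "one_hole p P" "one_step l' X'" "one_hole q Q"
      "M = P ** X' ** Q" "m = p + l' + q" "p < \<tau>" "p + l' \<ge> \<tau>" by blast
    show ?thesis
      by (rule step.prems(1)[OF *(1,2) one_hole.step[OF *(3) step.hyps(2)]])
        (use * in \<open>auto simp: matrix_mul_assoc\<close>)
  next
    case False
    show ?thesis
      by (rule step.prems(1)[OF step.hyps one_hole.hole]) (use False step.prems in auto)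
  qed
qed

text \<open>
  A tree with at least \<open>2 * \<tau>\<close> leaves has a child with at least \<open>\<tau>\<close> leaves, so a descent into such
  children cannot jump over the window from \<open>\<tau>\<close> to \<open>2 * \<tau> - 1\<close>.
\<close>
lemma A_cut:
  assumes "v \<in> A n" "\<tau> \<ge> 1" "n \<ge> \<tau>"
  obtains M t z where "one_hole (n - t) M" "z \<in> A t" "v = M *v z" "\<tau> \<le> t" "t < 2 * \<tau>" "t \<le> n"
proof -
  have "\<exists>M t z. one_hole (n - t) M \<and> z \<in> A t \<and> v = M *v z \<and> \<tau> \<le> t \<and> t < 2 * \<tau> \<and> t \<le> n"
    using assms
  proof (induction rule: A_induct)
    case base
    then show ?case using one_hole.hole s_mem by (intro exI[of _ "mat 1"] exI[of _ 1] exI[of _ s]) auto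
  next
    case (mult m x n y)
    have prepend: ?case
      if X: "one_step a X" and "f x y = X *v w" "a + b = m + n" "b \<ge> \<tau>"
        and IH: "\<exists>M t z. one_hole (b - t) M \<and> z \<in> A t \<and> w = M *v z \<and> \<tau> \<le> t \<and> t < 2 * \<tau> \<and> t \<le> b"
      for a b X w
    proof -
      from IH obtain M t z where *: "one_hole (b - t) M" "z \<in> A t" "w = M *v z" "\<tau> \<le> t" "t < 2 * \<tau>" "t \<le> b"
        by blast
      have "one_hole (m + n - t) (X ** M)"
        using one_hole_mult[OF one_step_hole[OF X] *(1)] that(3) *(6)
        by (metis Nat.add_diff_assoc)
      then show ?thesis using * that
        by (intro exI[of _ "X ** M"] exI[of _ t] exI[of _ z]) (auto simp: matrix_vector_mul_assoc)
    qed
    consider "m + n < 2 * \<tau>" | "m \<ge> \<tau>" | "n \<ge> \<tau>" by linarith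
    then show ?case
    proof cases
      case 1
      then show ?thesis using one_hole.hole A_mult[OF mult.hyps] mult.prems
        by (intro exI[of _ "mat 1"] exI[of _ "m + n"] exI[of _ "f x y"]) auto
    next
      case 2
      show ?thesis
        by (rule prepend[OF one_step.right[OF mult.hyps(2)], of x m])
          (use 2 mult in \<open>auto simp: right_mult_apply\<close>)
    next
      case 3
      show ?thesis
        by (rule prepend[OF one_step.left[OF mult.hyps(1)], of y n])
          (use 3 mult in \<open>auto simp: left_mult_apply\<close>)
    qed
  qed
  then show ?thesis using that by blast
qed

section \<open>Upper bounds by a polynomial times an exponential\<close>

text \<open>
  Closing a tree from \<open>i\<close> to \<open>j\<close> by a fixed tree from \<open>j\<close> back to \<open>i\<close> turns an off-diagonal entry
  into a diagonal one at the cost of a constant.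
\<close>
lemma class_row_bound:
  assumes mu: "\<mu> > 0" and diag: "\<And>m M. one_hole m M \<Longrightarrow> M $ i $ i \<le> C * \<mu> ^ m" and "reach j i"
  shows "\<exists>D. \<forall>m M. one_hole m M \<longrightarrow> M $ i $ j \<le> D * \<mu> ^ m"
proof -
  from \<open>reach j i\<close> obtain q N where N: "one_hole q N" "N $ j $ i > 0"
    unfolding reach_def by blast
  have "M $ i $ j \<le> (C * \<mu> ^ q / N $ j $ i) * \<mu> ^ m" if "one_hole m M" for m M
  proof -
    have "M $ i $ j * N $ j $ i \<le> C * \<mu> ^ (m + q)"
      using mult_entry_ge[OF that N(1)] diag[OF one_hole_mult[OF that N(1)]] by (rule order_trans)
    with N(2) show ?thesis by (simp add: field_simps power_add)
  qed
  then show ?thesis by blast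
qed

text \<open>
  The base \<open>\<mu>\<close> is arbitrary: with \<open>\<mu> = lam\<close> the lemma gives the upper bound of the theorem, and with
  smaller \<open>\<mu>\<close> it produces the critical class on which the lower bound rests. A single natural number
  \<open>N\<close> serves as constant and as degree, so that enlarging it weakens the bound and finitely
  many bounds can be merged.

  The proof is by induction on the number of coordinates that \<open>k\<close> reaches. These are the class \<open>K\<close> of
  \<open>k\<close> and the set \<open>L\<close> of those strictly below, to which the induction hypothesis applies. A term
  \<open>c i i' j' * x $ i' * y $ j'\<close> with \<open>i\<close> in \<open>K\<close> has \<open>i'\<close> in \<open>K\<close>, and is passed on to the factor \<open>x\<close>, or
  \<open>j'\<close> in \<open>K\<close>, and is passed on to \<open>y\<close>, or both in \<open>L\<close>, and is estimated at once. So a tree with \<open>n\<close>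
  leaves produces one exit term for each of its \<open>2 * n - 1\<close> nodes.
\<close>
lemma entries_le_polynomial_times_exponential:
  assumes mu: "\<mu> > 0"
    and diag: "\<And>i. reach k i \<Longrightarrow> \<exists>C. \<forall>m M. one_hole m M \<longrightarrow> M $ i $ i \<le> C * \<mu> ^ m"
  shows "\<exists>N::nat. \<forall>n v. v \<in> A n \<longrightarrow> v $ k \<le> real N * real n ^ N * \<mu> ^ n"
  using diag
proof (induction "card {i. reach k i}" arbitrary: k rule: less_induct)
  case less
  define K where "K = {i. reach k i \<and> reach i k}"
  define L where "L = {i. reach k i \<and> \<not> reach i k}"
  have "k \<in> K" by (simp add: K_def)
  have "\<exists>N::nat. \<forall>n v. v \<in> A n \<longrightarrow> v $ j \<le> real N * real n ^ N * \<mu> ^ n" if "j \<in> L" for j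
  proof (rule less.hyps)
    have "reach k j" "\<not> reach j k" using that by (auto simp: L_def)
    then have "{i. reach j i} \<subset> {i. reach k i}"
      using reach_trans[of k j] reach_refl[of k] by auto
    then show "card {i. reach j i} < card {i. reach k i}"
      by (intro psubset_card_mono) auto
    show "\<exists>C. \<forall>m M. one_hole m M \<longrightarrow> M $ i $ i \<le> C * \<mu> ^ m" if "reach j i" for i
      using that \<open>j \<in> L\<close> by (intro less.prems) (auto simp: L_def intro: reach_trans)
  qed
  moreover have "(\<forall>n v. v \<in> A n \<longrightarrow> v $ j \<le> real N' * real n ^ N' * \<mu> ^ n)"
    if N: "\<forall>n v. v \<in> A n \<longrightarrow> v $ j \<le> real N * real n ^ N * \<mu> ^ n" and "N \<le> N'" for j N N'
  proof (intro allI impI)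
    fix n v assume v: "v \<in> A n"
    have "real N * real n ^ N * \<mu> ^ n \<le> real N' * real n ^ N' * \<mu> ^ n"
      using mu A_pos[OF v] \<open>N \<le> N'\<close>
      by (intro mult_right_mono mult_mono power_increasing) auto
    with N v show "v $ j \<le> real N' * real n ^ N' * \<mu> ^ n" by force
  qed
  ultimately have "\<exists>N\<ge>0. \<forall>j\<in>L. \<forall>n v. v \<in> A n \<longrightarrow> v $ j \<le> real N * real n ^ N * \<mu> ^ n"
    by (intro finite_uniform_bound) auto
  then obtain N where N: "\<And>j n v. j \<in> L \<Longrightarrow> v \<in> A n \<Longrightarrow> v $ j \<le> real N * real n ^ N * \<mu> ^ n"
    by blast
  obtain C0 where C0: "\<And>m M. one_hole m M \<Longrightarrow> M $ k $ k \<le> C0 * \<mu> ^ m"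
    using less.prems[of k] by auto
  have "\<exists>D. \<forall>m M. one_hole m M \<longrightarrow> M $ k $ i \<le> D * \<mu> ^ m" if "i \<in> K" for i
    using class_row_bound[OF mu C0] that unfolding K_def by blast
  moreover have "(\<forall>m M. one_hole m M \<longrightarrow> M $ k $ i \<le> D' * \<mu> ^ m)"
    if "\<forall>m M. one_hole m M \<longrightarrow> M $ k $ i \<le> D * \<mu> ^ m" "D \<le> D'" for i D D'
  proof (intro allI impI)
    fix m M assume "one_hole m M"
    moreover have "D * \<mu> ^ m \<le> D' * \<mu> ^ m" using that(2) mu by (intro mult_right_mono) auto
    ultimately show "M $ k $ i \<le> D' * \<mu> ^ m" using that(1) by force
  qed
  ultimately have "\<exists>C\<ge>0. \<forall>i\<in>K. \<forall>m M. one_hole m M \<longrightarrow> M $ k $ i \<le> C * \<mu> ^ m"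
    by (intro finite_uniform_bound) auto
  then obtain C where C: "C \<ge> 0" "\<And>i m M. i \<in> K \<Longrightarrow> one_hole m M \<Longrightarrow> M $ k $ i \<le> C * \<mu> ^ m"
    by blast

  define E where "E = real (CARD('d))^2 * (coeff_sum * real N ^ 2) + (\<Sum>i\<in>UNIV. s $ i) / \<mu>"
  define D where "D = real (card K) * (C * E)"
  have s_sum: "(\<Sum>i\<in>UNIV. s $ i) \<ge> 0"
    using s_pos by (intro sum_nonneg) (simp add: less_imp_le)
  have E: "E \<ge> 0" "real (CARD('d))^2 * (coeff_sum * real N ^ 2) \<le> E" "s $ i \<le> E * \<mu>" for i
  proof -
    show "E \<ge> 0" "real (CARD('d))^2 * (coeff_sum * real N ^ 2) \<le> E"
      unfolding E_def using coeff_sum_nonneg s_sum mu by auto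
    have "s $ i \<le> (\<Sum>i\<in>UNIV. s $ i)"
      using s_pos by (intro member_le_sum) (auto simp: less_imp_le)
    also have "\<dots> \<le> E * \<mu>"
      unfolding E_def using mu coeff_sum_nonneg by (simp add: distrib_right)
    finally show "s $ i \<le> E * \<mu>" .
  qed
  have "D \<ge> 0" unfolding D_def using C E by simp
  \<comment> \<open>The cost of one node: a path inside \<open>K\<close> from the root to it, times its exit term.\<close>
  have row: "(\<Sum>i\<in>K. M $ k $ i * e i) \<le> D * \<mu> ^ p * t"
    if M: "one_hole p M" and e: "\<And>i. i \<in> K \<Longrightarrow> e i \<le> E * t" "\<And>i. i \<in> K \<Longrightarrow> e i \<ge> 0" for M p e t
  proof -
    have "M $ k $ i * e i \<le> (C * \<mu> ^ p) * (E * t)" if "i \<in> K" for i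
      using C that M mu by (intro mult_mono e) auto
    then have "(\<Sum>i\<in>K. M $ k $ i * e i) \<le> real (card K) * ((C * \<mu> ^ p) * (E * t))"
      by (rule sum_bounded_above)
    then show ?thesis by (simp add: D_def mult_ac)
  qed

  \<comment> \<open>The matrix \<open>M\<close> is the part of the tree above \<open>v\<close>. Letting it grow while \<open>v\<close> shrinks
    keeps the path in one piece, so that the constant \<open>C\<close> is paid once per node and not once per step.\<close>
  have main: "(\<Sum>i\<in>K. M $ k $ i * v $ i) \<le> D * (2 * real n - 1) * real n ^ (2 * N) * \<mu> ^ (p + n)"
    if "v \<in> A n" "one_hole p M" for v n p M
    using that
  proof (induction arbitrary: p M rule: A_induct)
    case base
    have "(\<Sum>i\<in>K. M $ k $ i * s $ i) \<le> D * \<mu> ^ p * \<mu>"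
      using E(3) s_pos by (intro row base) (auto simp: less_imp_le)
    then show ?case by (simp add: mult_ac)
  next
    case (mult m x n y)
    define e where "e i = (\<Sum>i'\<in>L. \<Sum>j'\<in>L. c i i' j' * x $ i' * y $ j')" for i
    note xy = A_nonneg[OF mult.hyps(1)] A_nonneg[OF mult.hyps(2)]
    have mn: "m \<ge> 1" "n \<ge> 1" using mult.hyps A_pos by blast+
    have e_le: "e i \<le> E * (real (m + n) ^ (2 * N) * \<mu> ^ (m + n))" for i
    proof -
      have "c i i' j' * x $ i' * y $ j' \<le> coeff_sum * (real N ^ 2 * (real (m + n) ^ (2 * N) * \<mu> ^ (m + n)))"
        if "i' \<in> L" "j' \<in> L" for i' j'
      proof -
        have "x $ i' \<le> real N * real (m + n) ^ N * \<mu> ^ m"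
          by (rule order_trans[OF N[OF that(1) mult.hyps(1)]], use mu in \<open>intro mult_right_mono mult_left_mono power_mono\<close>) auto
        moreover have "y $ j' \<le> real N * real (m + n) ^ N * \<mu> ^ n"
          by (rule order_trans[OF N[OF that(2) mult.hyps(2)]], use mu in \<open>intro mult_right_mono mult_left_mono power_mono\<close>) auto
        ultimately have "c i i' j' * x $ i' * y $ j' \<le>
            coeff_sum * (real N * real (m + n) ^ N * \<mu> ^ m) * (real N * real (m + n) ^ N * \<mu> ^ n)"
          using xy mu coeff_sum_nonneg by (intro mult_mono coeff_le) (auto intro!: mult_nonneg_nonneg c_nonneg)
        also have "\<dots> = coeff_sum * (real N ^ 2 * ((real (m + n) ^ N * real (m + n) ^ N) * \<mu> ^ (m + n)))"
          by (simp add: power_add power2_eq_square mult_ac)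
        also have "real (m + n) ^ N * real (m + n) ^ N = real (m + n) ^ (2 * N)"
          by (simp only: mult_2 power_add)
        finally show ?thesis .
      qed
      then have "e i \<le> (\<Sum>i'\<in>L. \<Sum>j'\<in>L. coeff_sum * (real N ^ 2 * (real (m + n) ^ (2 * N) * \<mu> ^ (m + n))))"
        unfolding e_def by (intro sum_mono) auto
      also have "\<dots> = real (card L) ^ 2 * (coeff_sum * (real N ^ 2 * (real (m + n) ^ (2 * N) * \<mu> ^ (m + n))))"
        by (simp add: power2_eq_square)
      also have "\<dots> \<le> real (CARD('d)) ^ 2 * (coeff_sum * (real N ^ 2 * (real (m + n) ^ (2 * N) * \<mu> ^ (m + n))))"
        using mu coeff_sum_nonneg by (intro mult_right_mono power_mono) (auto intro!: card_mono)
      also have "\<dots> = (real (CARD('d)) ^ 2 * (coeff_sum * real N ^ 2)) * (real (m + n) ^ (2 * N) * \<mu> ^ (m + n))"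
        by (simp add: mult_ac)
      also have "\<dots> \<le> E * (real (m + n) ^ (2 * N) * \<mu> ^ (m + n))"
        using mu by (intro mult_right_mono E(2)) auto
      finally show ?thesis .
    qed
    have e_nonneg: "e i \<ge> 0" for i
      unfolding e_def using xy by (intro sum_nonneg mult_nonneg_nonneg c_nonneg)

    have split: "f x y $ i \<le> (\<Sum>i'\<in>K. right_mult y $ i $ i' * x $ i') + (\<Sum>j'\<in>K. left_mult x $ i $ j' * y $ j') + e i"
      if i: "i \<in> K" for i
    proof -
      let ?t = "\<lambda>i' j'. c i i' j' * x $ i' * y $ j'"
      have pointwise: "?t i' j' \<le> (if i' \<in> K then ?t i' j' else 0) + (if j' \<in> K then ?t i' j' else 0)
          + (if i' \<in> L then if j' \<in> L then ?t i' j' else 0 else 0)" for i' j'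
      proof (cases "c i i' j' = 0")
        case False
        then have "reach k i'" "reach k j'"
          using reach_coeff[OF False] i reach_trans unfolding K_def by blast+
        then have "i' \<in> K \<or> i' \<in> L" "j' \<in> K \<or> j' \<in> L" by (auto simp: K_def L_def)
        moreover have "?t i' j' \<ge> 0" using xy by (intro mult_nonneg_nonneg c_nonneg)
        ultimately show ?thesis by auto
      qed simp
      have "f x y $ i \<le> (\<Sum>i'\<in>UNIV. \<Sum>j'\<in>UNIV. (if i' \<in> K then ?t i' j' else 0) + (if j' \<in> K then ?t i' j' else 0)
          + (if i' \<in> L then if j' \<in> L then ?t i' j' else 0 else 0))"
        unfolding f_bilinear by (intro sum_mono pointwise)
      also have "\<dots> = (\<Sum>i'\<in>UNIV. \<Sum>j'\<in>UNIV. if i' \<in> K then ?t i' j' else 0)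
          + (\<Sum>j'\<in>UNIV. \<Sum>i'\<in>UNIV. if j' \<in> K then ?t i' j' else 0)
          + (\<Sum>i'\<in>UNIV. \<Sum>j'\<in>UNIV. if i' \<in> L then if j' \<in> L then ?t i' j' else 0 else 0)"
        by (subst (2) sum.swap) (simp add: sum.distrib)
      also have "(\<Sum>i'\<in>UNIV. \<Sum>j'\<in>UNIV. if i' \<in> K then ?t i' j' else 0) = (\<Sum>i'\<in>K. right_mult y $ i $ i' * x $ i')"
      proof -
        have "(\<Sum>i'\<in>UNIV. \<Sum>j'\<in>UNIV. if i' \<in> K then ?t i' j' else 0) = (\<Sum>i'\<in>UNIV. if i' \<in> K then \<Sum>j'\<in>UNIV. ?t i' j' else 0)"
          by (intro sum.cong) auto
        also have "\<dots> = (\<Sum>i'\<in>K. \<Sum>j'\<in>UNIV. ?t i' j')"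
          by (simp flip: sum.inter_restrict)
        finally have "(\<Sum>i'\<in>UNIV. \<Sum>j'\<in>UNIV. if i' \<in> K then ?t i' j' else 0) = (\<Sum>i'\<in>K. \<Sum>j'\<in>UNIV. ?t i' j')" .
        moreover have "right_mult y $ i $ i' * x $ i' = (\<Sum>j'\<in>UNIV. ?t i' j')" for i'
          unfolding right_mult_def
          by (simp add: sum_distrib_right) (intro sum.cong refl, simp add: mult_ac)
        ultimately show ?thesis by (simp only:)
      qed
      also have "(\<Sum>j'\<in>UNIV. \<Sum>i'\<in>UNIV. if j' \<in> K then ?t i' j' else 0) = (\<Sum>j'\<in>K. left_mult x $ i $ j' * y $ j')"
      proof -
        have "(\<Sum>j'\<in>UNIV. \<Sum>i'\<in>UNIV. if j' \<in> K then ?t i' j' else 0) = (\<Sum>j'\<in>UNIV. if j' \<in> K then \<Sum>i'\<in>UNIV. ?t i' j' else 0)"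
          by (intro sum.cong) auto
        also have "\<dots> = (\<Sum>j'\<in>K. \<Sum>i'\<in>UNIV. ?t i' j')"
          by (simp flip: sum.inter_restrict)
        finally have "(\<Sum>j'\<in>UNIV. \<Sum>i'\<in>UNIV. if j' \<in> K then ?t i' j' else 0) = (\<Sum>j'\<in>K. \<Sum>i'\<in>UNIV. ?t i' j')" .
        moreover have "left_mult x $ i $ j' * y $ j' = (\<Sum>i'\<in>UNIV. ?t i' j')" for j'
          unfolding left_mult_def by (simp add: sum_distrib_right)
        ultimately show ?thesis by (simp only:)
      qed
      also have "(\<Sum>i'\<in>UNIV. \<Sum>j'\<in>UNIV. if i' \<in> L then if j' \<in> L then ?t i' j' else 0 else 0) = e i"
      proof -
        have "(\<Sum>i'\<in>UNIV. \<Sum>j'\<in>UNIV. if i' \<in> L then if j' \<in> L then ?t i' j' else 0 else 0)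
            = (\<Sum>i'\<in>UNIV. if i' \<in> L then \<Sum>j'\<in>UNIV. if j' \<in> L then ?t i' j' else 0 else 0)"
          by (intro sum.cong) auto
        then show ?thesis by (simp add: e_def flip: sum.inter_restrict)
      qed
      finally show ?thesis .
    qed

    have descend: "(\<Sum>i\<in>K. M $ k $ i * (\<Sum>i'\<in>K. X $ i $ i' * w $ i'))
        \<le> (\<Sum>i'\<in>K. (M ** X) $ k $ i' * w $ i')"
      if X: "one_step l X" and w: "\<And>i'. w $ i' \<ge> 0" for X :: "real^'d^'d" and w :: "real^'d" and l
    proof -
      have "(\<Sum>i\<in>K. M $ k $ i * (\<Sum>i'\<in>K. X $ i $ i' * w $ i'))
          = (\<Sum>i\<in>K. \<Sum>i'\<in>K. M $ k $ i * (X $ i $ i' * w $ i'))"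
        by (simp add: sum_distrib_left)
      also have "\<dots> = (\<Sum>i'\<in>K. \<Sum>i\<in>K. M $ k $ i * (X $ i $ i' * w $ i'))" by (rule sum.swap)
      also have "\<dots> = (\<Sum>i'\<in>K. (\<Sum>i\<in>K. M $ k $ i * X $ i $ i') * w $ i')"
        by (simp add: sum_distrib_right mult.assoc)
      also have "\<dots> \<le> (\<Sum>i'\<in>K. (M ** X) $ k $ i' * w $ i')"
        unfolding matrix_matrix_mult_def
        using one_step_nonneg[OF X] one_hole_nonneg[OF mult.prems] w
        by (auto intro!: sum_mono mult_right_mono sum_mono2 mult_nonneg_nonneg)
      finally show ?thesis .
    qed

    let ?R = "\<lambda>t q. D * (2 * real t - 1) * real (m + n) ^ (2 * N) * \<mu> ^ q"
    have weaken: "D * (2 * real t - 1) * real t ^ (2 * N) * \<mu> ^ q \<le> ?R t q" if "1 \<le> t" "t \<le> m + n" for t q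
      using that \<open>D \<ge> 0\<close> mu by (intro mult_right_mono mult_left_mono power_mono) auto
    have "(\<Sum>i\<in>K. M $ k $ i * f x y $ i)
        \<le> (\<Sum>i\<in>K. M $ k $ i * ((\<Sum>i'\<in>K. right_mult y $ i $ i' * x $ i') + (\<Sum>j'\<in>K. left_mult x $ i $ j' * y $ j') + e i))"
      by (intro sum_mono mult_left_mono split one_hole_nonneg[OF mult.prems])
    also have "\<dots> = (\<Sum>i\<in>K. M $ k $ i * (\<Sum>i'\<in>K. right_mult y $ i $ i' * x $ i'))
        + (\<Sum>i\<in>K. M $ k $ i * (\<Sum>j'\<in>K. left_mult x $ i $ j' * y $ j')) + (\<Sum>i\<in>K. M $ k $ i * e i)"
      by (simp add: distrib_left sum.distrib)
    also have "\<dots> \<le> ?R m (p + n + m) + ?R n (p + m + n) + D * \<mu> ^ p * (real (m + n) ^ (2 * N) * \<mu> ^ (m + n))"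
    proof (intro add_mono)
      show "(\<Sum>i\<in>K. M $ k $ i * (\<Sum>i'\<in>K. right_mult y $ i $ i' * x $ i')) \<le> ?R m (p + n + m)"
        using descend[OF one_step.right[OF mult.hyps(2)] xy(1)]
          mult.IH(1)[OF one_hole.step[OF mult.prems one_step.right[OF mult.hyps(2)]]]
          weaken[of m "p + n + m"] mn by linarith
      show "(\<Sum>i\<in>K. M $ k $ i * (\<Sum>j'\<in>K. left_mult x $ i $ j' * y $ j')) \<le> ?R n (p + m + n)"
        using descend[OF one_step.left[OF mult.hyps(1)] xy(2)]
          mult.IH(2)[OF one_hole.step[OF mult.prems one_step.left[OF mult.hyps(1)]]]
          weaken[of n "p + m + n"] mn by linarith
      show "(\<Sum>i\<in>K. M $ k $ i * e i) \<le> D * \<mu> ^ p * (real (m + n) ^ (2 * N) * \<mu> ^ (m + n))"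
        by (intro row mult.prems e_le e_nonneg)
    qed
    also have "\<dots> = D * (2 * real (m + n) - 1) * real (m + n) ^ (2 * N) * \<mu> ^ (p + (m + n))"
      by (simp add: power_add algebra_simps)
    finally show ?case .
  qed

  obtain N' where N': "2 * D \<le> real N'" "2 * N + 1 \<le> N'"
  proof
    show "2 * D \<le> real (nat \<lceil>2 * D\<rceil> + (2 * N + 1))" by (simp add: le_nat_iff) linarith
  qed simp
  have "v $ k \<le> real N' * real n ^ N' * \<mu> ^ n" if v: "v \<in> A n" for n v
  proof -
    have n: "n \<ge> 1" by (rule A_pos[OF v])
    have "v $ k = (\<Sum>i\<in>K. (mat 1 :: real^'d^'d) $ k $ i * v $ i)"
      using \<open>k \<in> K\<close> by (simp add: mat_def if_distrib[of "\<lambda>t. t * _"] sum.delta cong: if_cong)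
    also have "\<dots> \<le> D * (2 * real n - 1) * real n ^ (2 * N) * \<mu> ^ n"
      using main[OF v one_hole.hole] by simp
    also have "\<dots> \<le> D * (2 * real n) * real n ^ (2 * N) * \<mu> ^ n"
      using \<open>D \<ge> 0\<close> mu by (intro mult_right_mono mult_left_mono) auto
    also have "\<dots> = (2 * D) * real n ^ (2 * N + 1) * \<mu> ^ n" by simp
    also have "\<dots> \<le> real N' * real n ^ N' * \<mu> ^ n"
      using N' n mu by (intro mult_right_mono mult_mono power_increasing) auto
    finally show ?thesis .
  qed
  then show ?case by blast
qed

end

section \<open>The growth rate and the critical classes\<close>

locale nonneg_bilinear_rate = nonneg_bilinear s c f
  for s :: "real^'d" and c f +
  fixes lam :: real
  assumes growth_rate: "(\<lambda>n. root n (growth f s n)) \<longlonglongrightarrow> lam"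
    and rate_pos: "lam > 0"
begin

lemma growth_le_eventually:
  assumes "\<mu> > lam"
  shows "\<exists>N. \<forall>n\<ge>N. growth f s n \<le> \<mu> ^ n"
proof -
  have "eventually (\<lambda>n. root n (growth f s n) < \<mu>) sequentially"
    using growth_rate assms by (rule order_tendstoD)
  then obtain N where N: "\<And>n. n \<ge> N \<Longrightarrow> root n (growth f s n) < \<mu>"
    unfolding eventually_sequentially by blast
  have "growth f s n \<le> \<mu> ^ n" if "n \<ge> max N 1" for n
  proof -
    from that have n: "n \<ge> 1" by simp
    then have "growth f s n = root n (growth f s n) ^ n" by (simp add: growth_nonneg)
    also have "\<dots> \<le> \<mu> ^ n"
      using N[of n] that n by (intro power_mono) (auto simp: growth_nonneg less_imp_le)
    finally show ?thesis .
  qed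
  then show ?thesis by blast
qed

lemma rate_le:
  assumes "\<mu> > 0" "\<And>n. n \<ge> 1 \<Longrightarrow> growth f s n \<le> C * \<mu> ^ n"
  shows "lam \<le> \<mu>"
proof -
  define C' where "C' = max C 1"
  have C': "C' > 0" "\<And>n. n \<ge> 1 \<Longrightarrow> growth f s n \<le> C' * \<mu> ^ n"
  proof -
    show "C' > 0" by (simp add: C'_def)
    fix n :: nat assume "n \<ge> 1"
    then have "growth f s n \<le> C * \<mu> ^ n" by (rule assms(2))
    also have "\<dots> \<le> C' * \<mu> ^ n" using assms(1) by (intro mult_right_mono) (auto simp: C'_def)
    finally show "growth f s n \<le> C' * \<mu> ^ n" .
  qed
  have "(\<lambda>n. root n C' * \<mu>) \<longlonglongrightarrow> 1 * \<mu>"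
    using C'(1) by (intro tendsto_intros LIMSEQ_root_const)
  moreover have "\<forall>\<^sub>F n in sequentially. root n (growth f s n) \<le> root n C' * \<mu>"
    using eventually_ge_at_top[of 1]
  proof eventually_elim
    case (elim n)
    then have "root n (growth f s n) \<le> root n (C' * \<mu> ^ n)"
      using C'(2)[of n] by simp
    also have "\<dots> = root n C' * \<mu>"
      using elim assms(1) by (simp add: real_root_mult real_root_power_cancel)
    finally show ?case .
  qed
  ultimately show ?thesis
    using tendsto_le[OF sequentially_bot _ growth_rate, of "\<lambda>n. root n C' * \<mu>" "1 * \<mu>"] by simp
qed

lemma one_hole_power:
  assumes "one_hole m M"
  shows "\<exists>N. one_hole (m * t) N \<and> (M $ i $ i) ^ t \<le> N $ i $ i"
proof (induction t)
  case 0
  show ?case using one_hole.hole by (intro exI[of _ "mat 1"]) (simp add: mat_def)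
next
  case (Suc t)
  then obtain N where N: "one_hole (m * t) N" "(M $ i $ i) ^ t \<le> N $ i $ i" by blast
  have "(M $ i $ i) ^ Suc t \<le> M $ i $ i * N $ i $ i"
    using N(2) one_hole_nonneg[OF assms, of i i] by (simp add: mult_left_mono)
  also have "\<dots> \<le> (M ** N) $ i $ i" by (rule mult_entry_ge[OF assms N(1)])
  finally show ?case
    using one_hole_mult[OF assms N(1)] by (intro exI[of _ "M ** N"]) (simp add: add.commute)
qed

text \<open>
  Filling \<open>t\<close> copies of the tree into each other gives products of \<open>m * t + 1\<close> factors with an entry of
  size at least \<open>(M $ i $ i) ^ t * s $ i\<close>, which must not outgrow the rate.
\<close>
lemma diag_le_rate_power:
  assumes M: "one_hole m M"
  shows "M $ i $ i \<le> lam ^ m"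
proof (rule ccontr)
  define x where "x = M $ i $ i"
  assume "\<not> M $ i $ i \<le> lam ^ m"
  then have x: "x > lam ^ m" by (simp add: x_def)
  have x0: "x > 0" using x rate_pos by (meson less_trans zero_less_power)
  have g: "x ^ t * s $ i \<le> growth f s (m * t + 1)" for t
  proof -
    from one_hole_power[OF M] obtain N where N: "one_hole (m * t) N" "x ^ t \<le> N $ i $ i"
      unfolding x_def by blast
    have "x ^ t * s $ i \<le> N $ i $ i * s $ i"
      using N(2) s_pos[of i] by (simp add: mult_right_mono)
    also have "\<dots> \<le> (N *v s) $ i" by (rule apply_entry_ge[OF N(1) s_mem])
    also have "\<dots> \<le> growth f s (m * t + 1)" by (rule A_le_growth[OF one_hole_apply[OF N(1) s_mem]])
    finally show ?thesis .
  qed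
  have unbounded: False if "y > 1" and "\<And>t. t \<ge> N \<Longrightarrow> y ^ t \<le> B" for y B :: real and N :: nat
  proof -
    obtain t where "B < y ^ t" using real_arch_pow[OF \<open>y > 1\<close>] by blast
    also have "\<dots> \<le> y ^ max t N" using \<open>y > 1\<close> by (intro power_increasing) auto
    also have "\<dots> \<le> B" by (intro that(2)) simp
    finally show False by simp
  qed
  show False
  proof (cases "m = 0")
    case True
    show False
      by (rule unbounded[of x 0 "growth f s 1 / s $ i"])
        (use True x g s_pos[of i] in \<open>auto simp: field_simps\<close>)
  next
    case False
    have "lam = root m (lam ^ m)" using False rate_pos by (simp add: real_root_power_cancel)
    also have "\<dots> < root m x" using False x by simp
    finally obtain \<mu> where mu: "lam < \<mu>" "\<mu> < root m x" using dense by blast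
    have mu0: "\<mu> > 0" using mu rate_pos by simp
    have "\<mu> ^ m < root m x ^ m" using mu mu0 False by (intro power_strict_mono) auto
    then have mx: "\<mu> ^ m < x" using False x0 by simp
    obtain N where N: "\<And>n. n \<ge> N \<Longrightarrow> growth f s n \<le> \<mu> ^ n"
      using growth_le_eventually[OF mu(1)] by blast
    show False
    proof (rule unbounded[of "x / \<mu> ^ m" N "\<mu> / s $ i"])
      show "x / \<mu> ^ m > 1" using mx mu0 by simp
      fix t assume t: "t \<ge> N"
      have "m * t \<ge> t" using False by simp
      with t have "m * t + 1 \<ge> N" by linarith
      from order_trans[OF g N[OF this]] have "x ^ t * s $ i \<le> (\<mu> ^ m) ^ t * \<mu>"
        by (simp add: power_mult mult.commute)
      then show "(x / \<mu> ^ m) ^ t \<le> \<mu> / s $ i"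
        using mu0 s_pos[of i] by (simp add: power_divide field_simps)
    qed
  qed
qed

lemma growth_upper_bound:
  "\<exists>N::nat. \<forall>n\<ge>1. growth f s n \<le> real N * real n ^ N * lam ^ n"
proof -
  have "\<exists>N::nat. \<forall>n v. v \<in> A n \<longrightarrow> v $ k \<le> real N * real n ^ N * lam ^ n" for k
    using diag_le_rate_power rate_pos
    by (intro entries_le_polynomial_times_exponential) (auto intro!: exI[of _ 1])
  then obtain N :: "'d \<Rightarrow> nat" where N: "\<And>k n v. v \<in> A n \<Longrightarrow> v $ k \<le> real (N k) * real n ^ N k * lam ^ n"
    by metis
  have "growth f s n \<le> real (Max (range N)) * real n ^ Max (range N) * lam ^ n" if n: "n \<ge> 1" for n
  proof -
    obtain v k where v: "v \<in> A n" "growth f s n = v $ k" using growth_attained[OF n] .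
    have "growth f s n \<le> real (N k) * real n ^ N k * lam ^ n" using N v by simp
    also have "\<dots> \<le> real (Max (range N)) * real n ^ Max (range N) * lam ^ n"
      using n rate_pos by (intro mult_right_mono mult_mono power_increasing) auto
    finally show ?thesis .
  qed
  then show ?thesis by blast
qed

text \<open>
  A coordinate is critical if the diagonal entries at it follow the full rate \<open>lam\<close>, in the sense that no
  smaller exponential bounds them.
\<close>
definition critical :: "'d \<Rightarrow> bool" where
  "critical k \<longleftrightarrow> (\<forall>\<mu> C. 0 < \<mu> \<longrightarrow> \<mu> < lam \<longrightarrow> (\<exists>m M. one_hole m M \<and> M $ k $ k > C * \<mu> ^ m))"

lemma decay_below_critical:
  assumes "\<And>i. reach k i \<Longrightarrow> \<not> critical i"
  shows "\<exists>\<mu> C. 0 < \<mu> \<and> \<mu> < lam \<and> (\<forall>n v. v \<in> A n \<longrightarrow> v $ k \<le> C * \<mu> ^ n)"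
proof -
  have "\<exists>\<mu> C. 0 < \<mu> \<and> \<mu> < lam \<and> (\<forall>m M. one_hole m M \<longrightarrow> M $ i $ i \<le> C * \<mu> ^ m)" if "reach k i" for i
    using assms[OF that] unfolding critical_def by (meson not_le)
  then obtain \<mu> C where C: "\<And>i. reach k i \<Longrightarrow> 0 < \<mu> i \<and> \<mu> i < lam"
      "\<And>i m M. reach k i \<Longrightarrow> one_hole m M \<Longrightarrow> M $ i $ i \<le> C i * \<mu> i ^ m"
    by metis
  define \<mu>0 where "\<mu>0 = Max (\<mu> ` {i. reach k i})"
  have nonempty: "\<mu> ` {i. reach k i} \<noteq> {}" using reach_refl[of k] by blast
  have le: "\<mu> i \<le> \<mu>0" if "reach k i" for i
    unfolding \<mu>0_def using that by (intro Max_ge) auto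
  have "\<mu>0 \<in> \<mu> ` {i. reach k i}" unfolding \<mu>0_def using nonempty by (intro Max_in) auto
  then have mu0: "0 < \<mu>0" "\<mu>0 < lam" using C by auto
  have "\<exists>C. \<forall>m M. one_hole m M \<longrightarrow> M $ i $ i \<le> C * \<mu>0 ^ m" if i: "reach k i" for i
  proof -
    have "M $ i $ i \<le> C i * \<mu>0 ^ m" if M: "one_hole m M" for m M
    proof -
      have "C i \<ge> 1" using C(2)[OF i one_hole.hole] by (simp add: mat_def)
      then have "C i * \<mu> i ^ m \<le> C i * \<mu>0 ^ m"
        using C(1)[OF i] le[OF i] by (intro mult_left_mono power_mono) auto
      with C(2)[OF i M] show ?thesis by linarith
    qed
    then show ?thesis by blast
  qed
  from entries_le_polynomial_times_exponential[OF mu0(1) this]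
  obtain N :: nat where N: "\<And>n v. v \<in> A n \<Longrightarrow> v $ k \<le> real N * real n ^ N * \<mu>0 ^ n" by blast
  obtain \<nu> where nu: "\<mu>0 < \<nu>" "\<nu> < lam" using dense[OF mu0(2)] by blast
  obtain B where B: "\<And>n. real n ^ N * \<mu>0 ^ n \<le> B * \<nu> ^ n"
    using polynomial_le_exponential[OF mu0(1) nu(1)] by blast
  have "v $ k \<le> (real N * B) * \<nu> ^ n" if "v \<in> A n" for n v
    using N[OF that] mult_left_mono[OF B[of n], of "real N"] by (simp add: mult.assoc)
  with nu mu0 show ?thesis by (intro exI[of _ \<nu>] exI[of _ "real N * B"]) auto
qed

lemma uniform_decay_below_critical:
  assumes "\<And>k i. k \<in> S \<Longrightarrow> reach k i \<Longrightarrow> \<not> critical i"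
  shows "\<exists>\<mu> C. 0 < \<mu> \<and> \<mu> < lam \<and> (\<forall>k\<in>S. \<forall>n v. v \<in> A n \<longrightarrow> v $ k \<le> C * \<mu> ^ n)"
proof -
  have "\<exists>\<mu> C. 0 < \<mu> \<and> \<mu> < lam \<and> (\<forall>n v. v \<in> A n \<longrightarrow> v $ k \<le> C * \<mu> ^ n)" if "k \<in> S" for k
    using assms that by (intro decay_below_critical)
  then obtain \<mu> C where C: "\<And>k. k \<in> S \<Longrightarrow> 0 < \<mu> k \<and> \<mu> k < lam"
      "\<And>k n v. k \<in> S \<Longrightarrow> v \<in> A n \<Longrightarrow> v $ k \<le> C k * \<mu> k ^ n"
    by metis
  define \<mu>0 where "\<mu>0 = Max (insert (lam / 2) (\<mu> ` S))"
  define C0 where "C0 = Max (insert 1 (C ` S))"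
  have le: "\<mu> k \<le> \<mu>0" "C k \<le> C0" if "k \<in> S" for k
    unfolding \<mu>0_def C0_def using that by (auto intro!: Max_ge)
  have "\<mu>0 \<in> insert (lam / 2) (\<mu> ` S)" unfolding \<mu>0_def by (intro Max_in) auto
  then have mu0: "0 < \<mu>0" "\<mu>0 < lam" using C rate_pos by auto
  have C0: "1 \<le> C0" unfolding C0_def by (intro Max_ge) auto
  have "v $ k \<le> C0 * \<mu>0 ^ n" if "k \<in> S" "v \<in> A n" for k n v
  proof -
    have "v $ k \<le> C k * \<mu> k ^ n" by (rule C(2)[OF that])
    also have "\<dots> \<le> C0 * \<mu>0 ^ n"
      using C(1)[OF that(1)] le[OF that(1)] C0 by (intro mult_mono power_mono) auto
    finally show ?thesis .
  qed
  with mu0 show ?thesis by (intro exI[of _ \<mu>0] exI[of _ C0]) auto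
qed

text \<open>
  If no coordinate were critical, all entries would grow at a rate below \<open>lam\<close>. Among the critical
  coordinates, one that reaches the fewest coordinates has nothing critical strictly below it.
\<close>
lemma minimal_critical:
  obtains k0 where "critical k0" "\<And>j i. reach k0 j \<Longrightarrow> \<not> reach j k0 \<Longrightarrow> reach j i \<Longrightarrow> \<not> critical i"
proof -
  have "\<exists>k. critical k"
  proof (rule ccontr)
    assume "\<nexists>k. critical k"
    then obtain \<mu> C where C: "0 < \<mu>" "\<mu> < lam" "\<And>k n v. v \<in> A n \<Longrightarrow> v $ k \<le> C * \<mu> ^ n"
      using uniform_decay_below_critical[of UNIV] by auto
    have "growth f s n \<le> C * \<mu> ^ n" if "n \<ge> 1" for n
      by (metis growth_attained[OF that] C(3))
    with rate_le[OF C(1)] C(2) show False by force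
  qed
  then obtain k where "critical k" ..
  then obtain k0 where k0: "critical k0"
    "\<And>i. critical i \<Longrightarrow> card {j. reach k0 j} \<le> card {j. reach i j}"
    using ex_has_least_nat[of critical k "\<lambda>i. card {j. reach i j}"] by blast
  show thesis
  proof (rule that[OF k0(1)])
    fix j i assume j: "reach k0 j" "\<not> reach j k0" and i: "reach j i"
    have "reach k0 i'" if "reach i i'" for i'
      using j(1) i that reach_trans by blast
    moreover have "\<not> reach i k0" using i j(2) reach_trans by blast
    ultimately have "{i'. reach i i'} \<subset> {i'. reach k0 i'}"
      using reach_refl[of k0] by blast
    then have "card {i'. reach i i'} < card {i'. reach k0 i'}"
      by (intro psubset_card_mono) auto
    with k0(2)[of i] show "\<not> critical i" by auto
  qed
qed

end

section \<open>Pieces of near-critical size in a minimal critical class\<close>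

locale critical_class = nonneg_bilinear_rate s c f lam
  for s :: "real^'d" and c f lam +
  fixes k0 :: 'd
  assumes crit: "critical k0"
    and minimal: "\<And>j i. reach k0 j \<Longrightarrow> \<not> reach j k0 \<Longrightarrow> reach j i \<Longrightarrow> \<not> critical i"
begin

text \<open>The class of the critical coordinate, and the coordinates strictly below it.\<close>
definition K :: "'d set" where
  "K = {i. reach k0 i \<and> reach i k0}"

definition L :: "'d set" where
  "L = {i. reach k0 i \<and> \<not> reach i k0}"

lemma k0_in_K: "k0 \<in> K"
  by (simp add: K_def)

lemma K_reach: "i \<in> K \<Longrightarrow> j \<in> K \<Longrightarrow> reach i j"
  unfolding K_def using reach_trans[of i k0 j] by simp

lemma K_between: "i \<in> K \<Longrightarrow> reach i a \<Longrightarrow> reach a j \<Longrightarrow> j \<in> K \<Longrightarrow> a \<in> K"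
  unfolding K_def using reach_trans[of k0 i a] reach_trans[of a j k0] by simp

lemma K_or_L: "i \<in> K \<Longrightarrow> reach i j \<Longrightarrow> j \<in> K \<or> j \<in> L"
  unfolding K_def L_def using reach_trans[of k0 i j] by auto

lemma L_decay:
  obtains \<mu> C where "0 < \<mu>" "\<mu> < lam" "\<And>j n v. j \<in> L \<Longrightarrow> v \<in> A n \<Longrightarrow> v $ j \<le> C * \<mu> ^ n"
proof -
  have "\<exists>\<mu> C. 0 < \<mu> \<and> \<mu> < lam \<and> (\<forall>j\<in>L. \<forall>n v. v \<in> A n \<longrightarrow> v $ j \<le> C * \<mu> ^ n)"
    by (rule uniform_decay_below_critical) (auto simp: L_def dest: minimal)
  then obtain \<mu> C where "0 < \<mu>" "\<mu> < lam" "\<forall>j\<in>L. \<forall>n v. v \<in> A n \<longrightarrow> v $ j \<le> C * \<mu> ^ n" by auto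
  then show ?thesis by (intro that[of \<mu> C]) auto
qed

lemma K_entry_bound:
  obtains C where "C \<ge> 1" "\<And>i j m M. i \<in> K \<Longrightarrow> j \<in> K \<Longrightarrow> one_hole m M \<Longrightarrow> M $ i $ j \<le> C * lam ^ m"
proof -
  have "\<exists>C\<ge>1. \<forall>(i, j) \<in> K \<times> K. \<forall>m M. one_hole m M \<longrightarrow> M $ i $ j \<le> C * lam ^ m"
  proof (rule finite_uniform_bound)
    fix ij assume "ij \<in> K \<times> K"
    then have "reach (snd ij) (fst ij)" by (auto intro: K_reach)
    then show "\<exists>C. case ij of (i, j) \<Rightarrow> \<forall>m M. one_hole m M \<longrightarrow> M $ i $ j \<le> C * lam ^ m"
      using class_row_bound[of lam "fst ij" 1 "snd ij"] diag_le_rate_power rate_pos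
      by (simp add: split_beta)
  next
    fix ij and C D :: real
    assume *: "case ij of (i, j) \<Rightarrow> \<forall>m M. one_hole m M \<longrightarrow> M $ i $ j \<le> C * lam ^ m" "C \<le> D"
    have "C * lam ^ m \<le> D * lam ^ m" for m using *(2) rate_pos by (intro mult_right_mono) auto
    with *(1) show "case ij of (i, j) \<Rightarrow> \<forall>m M. one_hole m M \<longrightarrow> M $ i $ j \<le> D * lam ^ m"
      by (auto split: prod.splits intro: order_trans)
  qed simp
  then obtain C where C: "C \<ge> 1"
    "\<forall>(i, j) \<in> K \<times> K. \<forall>m M. one_hole m M \<longrightarrow> M $ i $ j \<le> C * lam ^ m" by blast
  show ?thesis by (rule that[OF C(1)]) (use C(2) in blast)
qed

text \<open>
  In an entry inside \<open>K\<close> of a matrix product, only intermediate coordinates in \<open>K\<close> contribute.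
\<close>
lemma K_mult_entry_le:
  assumes M: "one_hole m M" and N: "one_hole n N" and "i \<in> K" "j \<in> K"
    and x: "\<And>a. a \<in> K \<Longrightarrow> M $ i $ a \<le> x" and y: "\<And>a. a \<in> K \<Longrightarrow> N $ a $ j \<le> y"
    and "x \<ge> 0" "y \<ge> 0"
  shows "(M ** N) $ i $ j \<le> real CARD('d) * x * y"
proof -
  have "M $ i $ a * N $ a $ j \<le> x * y" for a
  proof (cases "M $ i $ a = 0 \<or> N $ a $ j = 0")
    case True
    then show ?thesis using assms(7,8) by auto
  next
    case False
    then have "a \<in> K"
      using K_between[OF \<open>i \<in> K\<close> _ _ \<open>j \<in> K\<close>] reachI[OF M] reachI[OF N] by blast
    then show ?thesis
      using assms(7) by (intro mult_mono x y one_hole_nonneg[OF N]) auto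
  qed
  then have "(\<Sum>a\<in>UNIV. M $ i $ a * N $ a $ j) \<le> real (card (UNIV :: 'd set)) * (x * y)"
    by (intro sum_bounded_above) auto
  then show ?thesis by (simp add: matrix_matrix_mult_def mult.assoc)
qed

text \<open>
  The class can interact with itself: a coordinate of \<open>K\<close> may depend on coordinates of \<open>K\<close> in both
  factors. If it cannot, a product hanging off a path inside \<open>K\<close> contributes only through its entries
  in \<open>L\<close>.
\<close>
definition quadratic :: bool where
  "quadratic \<longleftrightarrow> (\<exists>a\<in>K. \<exists>b\<in>K. \<exists>j\<in>K. c a b j > 0 \<or> c a j b > 0)"

lemma one_step_entry_le:
  assumes X: "one_step l X" and ab: "a \<in> K" "b \<in> K" and "B \<ge> 0"
    and B: "\<And>y j. y \<in> A l \<Longrightarrow> j \<in> L \<or> (quadratic \<and> j \<in> K) \<Longrightarrow> y $ j \<le> B"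
  shows "X $ a $ b \<le> real CARD('d) * coeff_sum * B"
proof -
  have key: "co j * y $ j \<le> coeff_sum * B"
    if "y \<in> A l" and co: "\<And>j. co j = c a b j \<or> co j = c a j b" for y co j
  proof (cases "co j = 0")
    case True
    then show ?thesis using coeff_sum_nonneg \<open>B \<ge> 0\<close> by simp
  next
    case False
    then have pos: "c a b j > 0 \<or> c a j b > 0"
      using co[of j] c_nonneg[of a b j] c_nonneg[of a j b] by auto
    then have "reach a j" using reach_coeff[of a b j] reach_coeff[of a j b] by auto
    then have "j \<in> K \<or> j \<in> L" using K_or_L ab by blast
    then have "y $ j \<le> B" using pos ab by (intro B that) (auto simp: quadratic_def)
    then show ?thesis
      using co[of j] coeff_le c_nonneg A_nonneg[OF that(1)] coeff_sum_nonneg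
      by (intro mult_mono) (metis, auto)
  qed
  from X show ?thesis
  proof cases
    case (left y)
    have "X $ a $ b = (\<Sum>j\<in>UNIV. c a j b * y $ j)" by (simp add: left left_mult_def)
    also have "\<dots> \<le> real (card (UNIV :: 'd set)) * (coeff_sum * B)"
      by (rule sum_bounded_above) (rule key[OF left(2)], simp)
    finally show ?thesis by (simp add: mult.assoc)
  next
    case (right y)
    have "X $ a $ b = (\<Sum>j\<in>UNIV. c a b j * y $ j)" by (simp add: right right_mult_def)
    also have "\<dots> \<le> real (card (UNIV :: 'd set)) * (coeff_sum * B)"
      by (rule sum_bounded_above) (rule key[OF right(2)], simp)
    finally show ?thesis by (simp add: mult.assoc)
  qed
qed

text \<open>
  In the quadratic case the entries in \<open>K\<close> of a product are controlled by matrix entries inside \<open>K\<close>: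
  hang the product, moved to a suitable coordinate by a fixed tree, off a node of a path inside \<open>K\<close>.
  Through this, smallness of matrices passes to vectors, which could otherwise carry a polynomial
  factor.
\<close>
lemma quadratic_entry_le:
  obtains C where "C \<ge> 1"
    "\<And>j n v. quadratic \<Longrightarrow> j \<in> K \<Longrightarrow> v \<in> A n \<Longrightarrow>
      \<exists>q M a b. real q \<le> C \<and> one_hole (n + q) M \<and> a \<in> K \<and> b \<in> K \<and> v $ j \<le> C * M $ a $ b"
proof -
  have "\<exists>C\<ge>1. \<forall>j\<in>K. quadratic \<longrightarrow> (\<exists>q. real q \<le> C \<and> (\<forall>n v. v \<in> A n \<longrightarrow>
      (\<exists>M a b. one_hole (n + q) M \<and> a \<in> K \<and> b \<in> K \<and> v $ j \<le> C * M $ a $ b)))"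
  proof (rule finite_uniform_bound)
    fix j assume "j \<in> K"
    show "\<exists>C. quadratic \<longrightarrow> (\<exists>q. real q \<le> C \<and> (\<forall>n v. v \<in> A n \<longrightarrow>
      (\<exists>M a b. one_hole (n + q) M \<and> a \<in> K \<and> b \<in> K \<and> v $ j \<le> C * M $ a $ b)))"
    proof (cases quadratic)
      case True
      then obtain a b j' where abj: "a \<in> K" "b \<in> K" "j' \<in> K" "c a b j' > 0 \<or> c a j' b > 0"
        unfolding quadratic_def by blast
      obtain q N where N: "one_hole q N" "N $ j' $ j > 0"
        using K_reach[OF abj(3) \<open>j \<in> K\<close>] unfolding reach_def by blast
      define e where "e = max (c a b j') (c a j' b)"
      have e: "e > 0" using abj(4) by (auto simp: e_def)
      define C where "C = max (real q) (1 / (e * N $ j' $ j))"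
      have C: "1 \<le> C * (e * N $ j' $ j)"
      proof -
        have "1 / (e * N $ j' $ j) \<le> C" by (simp add: C_def)
        then show ?thesis using e N(2) by (simp add: divide_le_eq)
      qed
      have "\<exists>M a b. one_hole (n + q) M \<and> a \<in> K \<and> b \<in> K \<and> v $ j \<le> C * M $ a $ b" if v: "v \<in> A n" for n v
      proof -
        have w: "N *v v \<in> A (q + n)" by (rule one_hole_apply[OF N(1) v])
        obtain X where X: "one_step (q + n) X" "e * (N *v v) $ j' \<le> X $ a $ b"
        proof (cases "c a b j' \<ge> c a j' b")
          case True
          then show ?thesis
            using that[OF one_step.right[OF w]] right_mult_entry_ge[OF w, of a b j'] by (simp add: e_def)
        next
          case False
          then show ?thesis
            using that[OF one_step.left[OF w]] left_mult_entry_ge[OF w, of a j' b] by (simp add: e_def max_def)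
        qed
        have "v $ j \<le> (C * (e * N $ j' $ j)) * v $ j"
          using C A_nonneg[OF v, of j] mult_right_mono[of 1] by fastforce
        also have "\<dots> = C * (e * (N $ j' $ j * v $ j))" by simp
        also have "\<dots> \<le> C * (e * (N *v v) $ j')"
          using e by (intro mult_left_mono apply_entry_ge[OF N(1) v]) (auto simp: C_def)
        also have "\<dots> \<le> C * X $ a $ b"
          using X(2) by (intro mult_left_mono) (auto simp: C_def)
        finally show ?thesis using one_step_hole[OF X(1)] abj by (auto simp: add.commute)
      qed
      moreover have "real q \<le> C" by (simp add: C_def)
      ultimately show ?thesis by blast
    qed simp
  next
    fix j and C D :: real
    assume *: "quadratic \<longrightarrow> (\<exists>q. real q \<le> C \<and> (\<forall>n v. v \<in> A n \<longrightarrow>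
      (\<exists>M a b. one_hole (n + q) M \<and> a \<in> K \<and> b \<in> K \<and> v $ j \<le> C * M $ a $ b)))" and "C \<le> D"
    have "C * M $ a $ b \<le> D * M $ a $ b" if "one_hole m M" for m M a b
      using \<open>C \<le> D\<close> by (intro mult_right_mono one_hole_nonneg[OF that])
    then show "quadratic \<longrightarrow> (\<exists>q. real q \<le> D \<and> (\<forall>n v. v \<in> A n \<longrightarrow>
      (\<exists>M a b. one_hole (n + q) M \<and> a \<in> K \<and> b \<in> K \<and> v $ j \<le> D * M $ a $ b)))"
      using * \<open>C \<le> D\<close> by (meson order_trans)
  qed simp
  then obtain C where C: "C \<ge> 1" "\<And>j. j \<in> K \<Longrightarrow> quadratic \<Longrightarrow> \<exists>q. real q \<le> C \<and> (\<forall>n v. v \<in> A n \<longrightarrow>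
      (\<exists>M a b. one_hole (n + q) M \<and> a \<in> K \<and> b \<in> K \<and> v $ j \<le> C * M $ a $ b))" by blast
  show ?thesis
    by (rule that[OF C(1)]) (use C(2) in blast)
qed

text \<open>
  Suppose that all entries inside \<open>K\<close> of trees with a hole and \<open>m\<close> leaves, for \<open>m\<close> between \<open>\<tau>\<close> and
  \<open>8 * \<tau>\<close>, are below \<open>(\<alpha> / 2) * lam ^ m\<close>. Put \<open>\<beta> = \<rho> * lam\<close> with \<open>\<rho>\<close> so close to \<open>1\<close> that
  \<open>\<rho> ^ m \<ge> 1 / 2\<close> for these \<open>m\<close>. Then the entries are at most \<open>\<alpha> * \<beta> ^ m\<close> for these \<open>m\<close>, and this
  bound propagates to all larger \<open>m\<close>, because every tree splits into two parts of size at least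
  \<open>\<tau>\<close>, and the square of the small number \<open>\<alpha>\<close> absorbs all the constants that splitting costs.
  The part to cut is the path to the hole, or, if nearly all leaves hang off a single node of the
  path, the product that hangs off there; the entries of the latter in \<open>L\<close> are negligible. In the end \<open>\<beta> < lam\<close> contradicts criticality.
\<close>
lemma large_pieces:
  "\<exists>\<epsilon>>0. \<exists>\<tau>0\<ge>1. \<forall>\<tau>\<ge>\<tau>0. \<exists>m M i j. \<tau> \<le> m \<and> m \<le> 8 * \<tau> \<and> one_hole m M \<and> i \<in> K \<and> j \<in> K
      \<and> \<epsilon> * lam ^ m \<le> M $ i $ j"
proof -
  obtain C1 where C1: "C1 \<ge> 1" "\<And>i j m M. i \<in> K \<Longrightarrow> j \<in> K \<Longrightarrow> one_hole m M \<Longrightarrow> M $ i $ j \<le> C1 * lam ^ m"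
    by (rule K_entry_bound) blast
  obtain \<mu> C3 where mu: "0 < \<mu>" "\<mu> < lam" and C3: "\<And>j n v. j \<in> L \<Longrightarrow> v \<in> A n \<Longrightarrow> v $ j \<le> C3 * \<mu> ^ n"
    by (rule L_decay) blast
  obtain C4 where C4: "C4 \<ge> 1" "\<And>j n v. quadratic \<Longrightarrow> j \<in> K \<Longrightarrow> v \<in> A n \<Longrightarrow>
      \<exists>q M a b. real q \<le> C4 \<and> one_hole (n + q) M \<and> a \<in> K \<and> b \<in> K \<and> v $ j \<le> C4 * M $ a $ b"
    by (rule quadratic_entry_le) blast
  define d where "d = real CARD('d)"
  have d: "d \<ge> 1" unfolding d_def by (simp add: Suc_leI)
  define lam1 where "lam1 = max 1 lam"
  define U where "U = C4 * lam1 ^ nat \<lceil>C4\<rceil>"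
  have lam1: "lam1 \<ge> 1" "lam \<le> lam1" by (auto simp: lam1_def)
  have U: "U \<ge> 1" using C4(1) lam1 mult_mono[of 1 C4 1 "lam1 ^ nat \<lceil>C4\<rceil>"] by (auto simp: U_def)
  define \<sigma> where "\<sigma> = Min (range (($) s))"
  have sigma: "\<sigma> > 0" "\<And>i. \<sigma> \<le> s $ i"
    unfolding \<sigma>_def using s_pos by (auto simp: Min_gr_iff)
  define C5 where "C5 = max 1 (d * U ^ 2 * lam1 / \<sigma>)"
  define C2 where "C2 = d * coeff_sum * C5"
  have C5: "C5 \<ge> 1" and C2: "C2 \<ge> 0" using d coeff_sum_nonneg by (auto simp: C5_def C2_def)
  \<comment> \<open>Cutting the path costs the factor \<open>d * \<alpha>\<close>, cutting a hanging product \<open>2 * d^2 * C1^2 * C2 * \<alpha>\<close>;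
    the choice of \<open>\<alpha>\<close> makes both at most \<open>1\<close>.\<close>
  define W where "W = 1 + d + 2 * d^2 * C1^2 * C2"
  define \<alpha> where "\<alpha> = 1 / W"
  have "2 * d^2 * C1^2 * C2 \<ge> 0" using C2 by simp
  then have W: "W \<ge> 1" "d \<le> W" "2 * d^2 * C1^2 * C2 \<le> W" using d by (auto simp: W_def)
  then have alpha: "0 < \<alpha>" "\<alpha> \<le> 1" "d * \<alpha> \<le> 1" "2 * d^2 * C1^2 * C2 * \<alpha> \<le> 1"
    by (auto simp: \<alpha>_def divide_le_eq)
  \<comment> \<open>For large \<open>\<tau>\<close> we have \<open>\<beta> \<ge> \<nu> > \<mu>\<close>, so that coordinates in \<open>L\<close> are negligible against
    \<open>\<alpha>^2 * \<beta> ^ n\<close>.\<close>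
  obtain \<nu> where nu: "\<mu> < \<nu>" "\<nu> < lam" using dense[OF mu(2)] by blast
  have nu0: "\<nu> > 0" using nu mu by simp

  have "(\<lambda>n. C3 * (\<mu> / \<nu>) ^ n) \<longlonglongrightarrow> C3 * 0"
    using mu nu nu0 by (intro tendsto_mult tendsto_const LIMSEQ_power_zero) auto
  then have "\<forall>\<^sub>F n in sequentially. C3 * (\<mu> / \<nu>) ^ n < \<alpha> ^ 2"
    by (rule order_tendstoD) (use alpha in simp)
  then obtain \<tau>1 where tau1: "\<And>n. n \<ge> \<tau>1 \<Longrightarrow> C3 * (\<mu> / \<nu>) ^ n < \<alpha> ^ 2"
    unfolding eventually_sequentially by blast
  obtain \<tau>2 :: nat where tau2: "1 / (1 - \<nu> / lam) \<le> real \<tau>2" using real_arch_simple by blast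
  define \<tau>0 where "\<tau>0 = max \<tau>1 (max \<tau>2 (nat \<lceil>C4\<rceil> + 1))"

  have "\<exists>m M i j. \<tau> \<le> m \<and> m \<le> 8 * \<tau> \<and> one_hole m M \<and> i \<in> K \<and> j \<in> K \<and> \<alpha> / 2 * lam ^ m \<le> M $ i $ j"
    if "\<tau> \<ge> \<tau>0" for \<tau>
  proof (rule ccontr)
    assume contra: "\<not> ?thesis"
    have tau: "\<tau> \<ge> \<tau>1" "\<tau> \<ge> \<tau>2" "real \<tau> \<ge> C4 + 1" "\<tau> \<ge> 1"
      using that real_nat_ceiling_ge[of C4] unfolding \<tau>0_def by linarith+
    define \<rho> where "\<rho> = 1 - 1 / (16 * real \<tau>)"
    define \<beta> where "\<beta> = \<rho> * lam"
    have rho: "0 < \<rho>" "\<rho> < 1" using tau(4) by (auto simp: \<rho>_def field_simps)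
    have rho_half: "1 / 2 \<le> \<rho> ^ m" if "m \<le> 8 * \<tau>" for m
    proof -
      have "1 + real m * (- (1 / (16 * real \<tau>))) \<le> (1 + (- (1 / (16 * real \<tau>)))) ^ m"
        using tau(4) by (intro Bernoulli_inequality) (simp add: field_simps)
      moreover have "real m * (1 / (16 * real \<tau>)) \<le> 1 / 2"
        using that tau(4) by (simp add: field_simps)
      ultimately show ?thesis by (simp add: \<rho>_def)
    qed
    have beta: "0 < \<beta>" "\<beta> < lam" using rho rate_pos by (auto simp: \<beta>_def)
    have beta_half: "lam ^ m \<le> 2 * \<beta> ^ m" if "m \<le> 8 * \<tau>" for m
      using rho_half[OF that] rate_pos by (simp add: \<beta>_def power_mult_distrib)
    have "\<nu> \<le> \<beta>"
    proof -
      have "1 - \<nu> / lam > 0" using nu rate_pos by simp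
      moreover have "1 / (1 - \<nu> / lam) \<le> 16 * real \<tau>" using tau2 tau(2) by linarith
      ultimately have "1 / (16 * real \<tau>) \<le> 1 - \<nu> / lam"
        using tau(4) by (simp add: field_simps)
      then have "\<nu> / lam \<le> \<rho>" by (simp add: \<rho>_def)
      then show ?thesis using rate_pos by (simp add: \<beta>_def divide_le_eq)
    qed
    have low: "y $ j \<le> \<alpha> ^ 2 * \<beta> ^ l" if "j \<in> L" "y \<in> A l" "l \<ge> \<tau>" for j y l
    proof -
      have "y $ j \<le> C3 * (\<mu> / \<nu>) ^ l * \<nu> ^ l"
        using C3[OF that(1,2)] nu0 by (simp add: power_divide)
      also have "\<dots> \<le> \<alpha> ^ 2 * \<beta> ^ l"
        using tau1[of l] that(3) tau(1) nu0 \<open>\<nu> \<le> \<beta>\<close> by (intro mult_mono power_mono) auto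
      finally show ?thesis .
    qed

    have small: "M $ i $ j \<le> \<alpha> * \<beta> ^ m" if "m \<ge> \<tau>" "one_hole m M" "i \<in> K" "j \<in> K" for m M i j
      using that
    proof (induction m arbitrary: M i j rule: less_induct)
      case (less m)
      show ?case
      proof (cases "m \<le> 8 * \<tau>")
        case True
        then have "M $ i $ j \<le> \<alpha> / 2 * lam ^ m" using contra less.prems by (meson not_le less_imp_le)
        also have "\<dots> \<le> \<alpha> / 2 * (2 * \<beta> ^ m)"
          using alpha by (intro mult_left_mono beta_half True) auto
        finally show ?thesis by simp
      next
        case False
        obtain p P l X q Q where cut: "one_hole p P" "one_step l X" "one_hole q Q"
          "M = P ** X ** Q" "m = p + l + q" "p < \<tau>" "p + l \<ge> \<tau>"
          using one_hole_cut[OF less.prems(2) tau(4) less.prems(1)] .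
        note PX = one_hole.step[OF cut(1,2)]
        show ?thesis
        proof (cases "q \<ge> \<tau>")
          case True
          have "(P ** X ** Q) $ i $ j \<le> d * (\<alpha> * \<beta> ^ (p + l)) * (\<alpha> * \<beta> ^ q)"
            unfolding d_def
            using True cut tau(4) less.prems alpha beta
            by (intro K_mult_entry_le[OF PX cut(3)] less.IH PX cut(3)) auto
          also have "\<dots> = (d * \<alpha>) * (\<alpha> * \<beta> ^ m)" by (simp add: cut(5) power_add)
          also have "\<dots> \<le> 1 * (\<alpha> * \<beta> ^ m)"
            using alpha beta by (intro mult_right_mono) auto
          finally show ?thesis by (simp add: cut(4))
        next
          case q: False
          \<comment> \<open>Both ends of the path are short, so nearly all leaves hang off the node \<open>X\<close>.\<close>
          have l: "l > 6 * \<tau>" using False q cut(5,6) by linarith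
          have K_le: "v $ k \<le> U * \<alpha> * \<beta> ^ n"
            if v: quadratic "k \<in> K" "v \<in> A n" "n \<ge> \<tau>" "n + \<tau> \<le> m" for v n k
          proof -
            obtain r N a b where N: "real r \<le> C4" "one_hole (n + r) N" "a \<in> K" "b \<in> K" "v $ k \<le> C4 * N $ a $ b"
              using C4(2)[OF v(1-3)] by blast
            have "n + r < m" using N(1) tau(3) v(5) by linarith
            have "\<beta> ^ r \<le> lam1 ^ r" using beta lam1 by (intro power_mono) auto
            also have "\<dots> \<le> lam1 ^ nat \<lceil>C4\<rceil>"
              using N(1) lam1 by (intro power_increasing) (linarith, auto)
            finally have r: "\<beta> ^ r \<le> lam1 ^ nat \<lceil>C4\<rceil>" .
            have "v $ k \<le> C4 * N $ a $ b" by (rule N(5))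
            also have "\<dots> \<le> C4 * (\<alpha> * \<beta> ^ (n + r))"
              using \<open>n + r < m\<close> v(4) C4(1) N by (intro mult_left_mono less.IH) auto
            also have "\<dots> = C4 * (\<alpha> * \<beta> ^ n) * \<beta> ^ r" by (simp add: power_add)
            also have "\<dots> \<le> C4 * (\<alpha> * \<beta> ^ n) * lam1 ^ nat \<lceil>C4\<rceil>"
              using C4(1) alpha beta by (intro mult_left_mono r) auto
            finally show ?thesis by (simp add: U_def mult_ac)
          qed
          have "y $ k \<le> C5 * \<alpha> ^ 2 * \<beta> ^ l"
            if y: "y \<in> A l" and k: "k \<in> L \<or> (quadratic \<and> k \<in> K)" for y k
            using k
          proof
            assume "k \<in> L"
            then have "y $ k \<le> 1 * (\<alpha> ^ 2 * \<beta> ^ l)" using low[OF _ y] l by simp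
            also have "\<dots> \<le> C5 * (\<alpha> ^ 2 * \<beta> ^ l)"
              using C5 alpha beta by (intro mult_right_mono) auto
            finally show ?thesis by simp
          next
            assume k: "quadratic \<and> k \<in> K"
            \<comment> \<open>Cut the hanging product so that both parts have at least \<open>2 * \<tau>\<close> leaves. The induction
              hypothesis is used for one part together with a connecting tree, which is at most as large
              as the other part.\<close>
            have "l div 3 \<ge> 1" "l \<ge> l div 3" using l tau(4) by auto
            then obtain N t z where N: "one_hole (l - t) N" "z \<in> A t" "y = N *v z"
                "l div 3 \<le> t" "t < 2 * (l div 3)" "t \<le> l"
              using A_cut[OF y] by blast
            have lm: "l \<le> m" using cut(5) by simp
            have t: "t \<ge> 2 * \<tau>" "t + 2 * \<tau> \<le> l" using N(4,5) l by auto
            have root: "\<sigma> * N $ k $ i \<le> U * \<alpha> * \<beta> ^ (l - t + 1)" for i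
            proof -
              have "\<sigma> * N $ k $ i \<le> N $ k $ i * s $ i"
                using mult_right_mono[OF sigma(2)[of i] one_hole_nonneg[OF N(1), of k i]] by (simp add: mult.commute)
              also have "\<dots> \<le> (N *v s) $ k" by (rule apply_entry_ge[OF N(1) s_mem])
              also have "\<dots> \<le> U * \<alpha> * \<beta> ^ (l - t + 1)"
                using k t lm tau(4) by (intro K_le one_hole_apply[OF N(1) s_mem]) auto
              finally show ?thesis .
            qed
            have sub: "z $ i \<le> U * \<alpha> * \<beta> ^ t" if "reach k i" for i
            proof (cases "i \<in> K")
              case True
              then show ?thesis using k t lm tau(4) N(2) by (intro K_le) auto
            next
              case False
              with that k have "i \<in> L" using K_or_L by blast
              then have "z $ i \<le> \<alpha> ^ 2 * \<beta> ^ t" using low N(2) t by auto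
              also have "\<dots> \<le> (U * \<alpha>) * \<beta> ^ t"
                using U alpha beta unfolding power2_eq_square
                by (intro mult_right_mono) auto
              finally show ?thesis .
            qed
            have "N $ k $ i * z $ i \<le> (U * \<alpha> * \<beta> ^ (l - t + 1) / \<sigma>) * (U * \<alpha> * \<beta> ^ t)" for i
            proof (cases "N $ k $ i = 0")
              case True
              then show ?thesis using U alpha beta sigma by simp
            next
              case False
              have "N $ k $ i \<le> U * \<alpha> * \<beta> ^ (l - t + 1) / \<sigma>"
                using root[of i] sigma(1) by (simp add: field_simps)
              then show ?thesis
                using sub[OF reachI[OF N(1) False]] A_nonneg[OF N(2)] U alpha beta sigma(1)
                by (intro mult_mono) auto
            qed
            then have "(\<Sum>i\<in>UNIV. N $ k $ i * z $ i) \<le>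
                real (card (UNIV :: 'd set)) * ((U * \<alpha> * \<beta> ^ (l - t + 1) / \<sigma>) * (U * \<alpha> * \<beta> ^ t))"
              by (intro sum_bounded_above) auto
            then have "y $ k \<le> d * ((U * \<alpha> * \<beta> ^ (l - t + 1) / \<sigma>) * (U * \<alpha> * \<beta> ^ t))"
              by (simp add: N(3) matrix_vector_mult_def d_def)
            also have "\<dots> = (d * U ^ 2 * \<beta> / \<sigma>) * (\<alpha> ^ 2 * (\<beta> ^ (l - t) * \<beta> ^ t))"
              by (simp add: power2_eq_square)
            also have "\<beta> ^ (l - t) * \<beta> ^ t = \<beta> ^ l"
              using N(6) by (simp flip: power_add)
            also have "(d * U ^ 2 * \<beta> / \<sigma>) * (\<alpha> ^ 2 * \<beta> ^ l) \<le> C5 * (\<alpha> ^ 2 * \<beta> ^ l)"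
            proof (intro mult_right_mono)
              have "d * U ^ 2 * \<beta> / \<sigma> \<le> d * U ^ 2 * lam1 / \<sigma>"
                using d U sigma(1) beta lam1 by (intro divide_right_mono mult_left_mono) auto
              then show "d * U ^ 2 * \<beta> / \<sigma> \<le> C5" by (simp add: C5_def)
            qed (use alpha beta in auto)
            finally show ?thesis by simp
          qed
          then have X: "X $ a $ b \<le> C2 * \<alpha> ^ 2 * \<beta> ^ l" if "a \<in> K" "b \<in> K" for a b
            using one_step_entry_le[OF cut(2) that, of "C5 * \<alpha> ^ 2 * \<beta> ^ l"] C5 alpha beta
            by (simp add: C2_def d_def mult_ac)
          have PX_le: "(P ** X) $ i $ a \<le> d * (C1 * lam ^ p) * (C2 * \<alpha> ^ 2 * \<beta> ^ l)" if "a \<in> K" for a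
            unfolding d_def
            using that less.prems C1 C2 alpha beta rate_pos
            by (intro K_mult_entry_le[OF cut(1) one_step_hole[OF cut(2)]] X C1(2) cut(1)) auto
          have "(P ** X ** Q) $ i $ j \<le> d * (d * (C1 * lam ^ p) * (C2 * \<alpha> ^ 2 * \<beta> ^ l)) * (C1 * lam ^ q)"
            using less.prems C1 C2 alpha beta rate_pos d unfolding d_def[symmetric]
            by (intro K_mult_entry_le[OF PX cut(3), folded d_def] PX_le C1(2) cut(3)) auto
          also have "\<dots> = d^2 * C1^2 * C2 * \<alpha>^2 * \<beta> ^ l * lam ^ (p + q)"
            by (simp add: power2_eq_square power_add mult_ac)
          also have "\<dots> \<le> d^2 * C1^2 * C2 * \<alpha>^2 * \<beta> ^ l * (2 * \<beta> ^ (p + q))"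
            using C2 beta q cut(6) by (intro mult_left_mono beta_half) auto
          also have "\<dots> = (2 * d^2 * C1^2 * C2 * \<alpha>) * (\<alpha> * \<beta> ^ m)"
            by (simp add: cut(5) power_add power2_eq_square mult_ac)
          also have "\<dots> \<le> 1 * (\<alpha> * \<beta> ^ m)"
            using alpha beta by (intro mult_right_mono) auto
          finally show ?thesis by (simp add: cut(4))
        qed
      qed
    qed

    obtain m M where M: "one_hole m M" "M $ k0 $ k0 > 2 * \<beta> ^ m"
      using crit beta unfolding critical_def by blast
    show False
    proof (cases "m \<ge> \<tau>")
      case True
      have "M $ k0 $ k0 \<le> \<alpha> * \<beta> ^ m" by (rule small[OF True M(1) k0_in_K k0_in_K])
      also have "\<dots> \<le> 2 * \<beta> ^ m" using alpha beta by (intro mult_right_mono) auto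
      finally show False using M(2) by simp
    next
      case False
      then show False using diag_le_rate_power[OF M(1), of k0] beta_half[of m] M(2) by simp
    qed
  qed
  then show ?thesis
    using alpha(1) by (intro exI[of _ "\<alpha> / 2"] conjI exI[of _ \<tau>0]) (auto simp: \<tau>0_def)
qed

section \<open>The polynomial lower bound\<close>

text \<open>
  Criticality provides a closed path inside \<open>K\<close> of positive length, and its first step can be made with
  the single factor \<open>s\<close>. Iterating such steps gives products of every size with positive entries in \<open>K\<close>.
\<close>
lemma step_within_K:
  assumes "k \<in> K"
  obtains X i where "one_step 1 X" "i \<in> K" "X $ k $ i > 0"
proof -
  obtain m M where M: "one_hole m M" "M $ k0 $ k0 > 1 * (lam / 2) ^ m"
    using crit[unfolded critical_def, rule_format, of "lam / 2" 1] rate_pos by auto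
  have "(lam / 2) ^ m > 0" using rate_pos by simp
  with M(2) have M0: "M $ k0 $ k0 > 0" by linarith
  have "m \<noteq> 0"
  proof
    assume "m = 0"
    with M(1) have "M = mat 1" by (cases rule: one_hole.cases) (auto dest: one_step_pos)
    with M(2) \<open>m = 0\<close> show False by (simp add: mat_def)
  qed
  obtain p P where P: "one_hole p P" "P $ k $ k0 > 0"
    using K_reach[OF assms k0_in_K] unfolding reach_def by blast
  obtain q Q where Q: "one_hole q Q" "Q $ k0 $ k > 0"
    using K_reach[OF k0_in_K assms] unfolding reach_def by blast
  define W where "W = P ** M ** Q"
  note PM = one_hole_mult[OF P(1) M(1)]
  have W: "one_hole (p + m + q) W" unfolding W_def by (rule one_hole_mult[OF PM Q(1)])
  have "0 < P $ k $ k0 * M $ k0 $ k0 * Q $ k0 $ k" using P(2) M0 Q(2) by simp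
  also have "\<dots> \<le> (P ** M) $ k $ k0 * Q $ k0 $ k"
    using Q(2) by (intro mult_right_mono mult_entry_ge[OF P(1) M(1)]) auto
  also have "\<dots> \<le> W $ k $ k" unfolding W_def by (rule mult_entry_ge[OF PM Q(1)])
  finally have Wk: "W $ k $ k > 0" .
  obtain p' P' l X q' Q' where cut: "one_hole p' P'" "one_step l X" "one_hole q' Q'"
      "W = P' ** X ** Q'" "p + m + q = p' + l + q'" "p' < 1"
    by (rule one_hole_cut[OF W, of 1]) (use \<open>m \<noteq> 0\<close> in auto)
  from cut(1,6) have "P' = mat 1" by (cases rule: one_hole.cases) (auto dest: one_step_pos)
  then have "(\<Sum>i\<in>UNIV. X $ k $ i * Q' $ i $ k) > 0"
    using Wk cut(4) by (simp add: matrix_matrix_mult_def[of X])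
  then obtain i where i: "X $ k $ i * Q' $ i $ k > 0"
    by (metis (mono_tags, lifting) not_le sum_nonpos)
  then have nz: "X $ k $ i \<noteq> 0" "Q' $ i $ k \<noteq> 0" by auto
  have "i \<in> K"
    using K_between[OF assms _ _ assms] reachI[OF one_step_hole[OF cut(2)] nz(1)] reachI[OF cut(3) nz(2)] by blast
  from cut(2) show thesis
  proof cases
    case (left y)
    have "(\<Sum>j\<in>UNIV. c k j i * y $ j) \<noteq> 0" using nz(1) by (simp add: left left_mult_def)
    then obtain j where "c k j i * y $ j \<noteq> 0" by (meson sum.not_neutral_contains_not_neutral)
    then have "c k j i * s $ j > 0" using c_nonneg[of k j i] s_pos[of j] by (simp add: less_le)
    with left_mult_entry_ge[OF s_mem, of k j i] have "left_mult s $ k $ i > 0" by linarith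
    with \<open>i \<in> K\<close> show thesis by (intro that[OF one_step.left[OF s_mem]])
  next
    case (right y)
    have "(\<Sum>j\<in>UNIV. c k i j * y $ j) \<noteq> 0" using nz(1) by (simp add: right right_mult_def)
    then obtain j where "c k i j * y $ j \<noteq> 0" by (meson sum.not_neutral_contains_not_neutral)
    then have "c k i j * s $ j > 0" using c_nonneg[of k i j] s_pos[of j] by (simp add: less_le)
    with right_mult_entry_ge[OF s_mem, of k i j] have "right_mult s $ k $ i > 0" by linarith
    with \<open>i \<in> K\<close> show thesis by (intro that[OF one_step.right[OF s_mem]])
  qed
qed

lemma crude_lower_bound:
  obtains E where "E \<ge> 1" "\<And>n k. n \<ge> 1 \<Longrightarrow> k \<in> K \<Longrightarrow> \<exists>v\<in>A n. 1 \<le> E ^ n * v $ k"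
proof -
  have "\<exists>E\<ge>1. \<forall>k\<in>K. \<exists>X i. one_step 1 X \<and> i \<in> K \<and> 1 \<le> E * X $ k $ i \<and> 1 \<le> E * s $ k"
  proof (rule finite_uniform_bound)
    fix k assume "k \<in> K"
    then obtain X i where X: "one_step 1 X" "i \<in> K" "X $ k $ i > 0" using step_within_K by blast
    define E where "E = max (1 / X $ k $ i) (1 / s $ k)"
    have "1 / X $ k $ i \<le> E" "1 / s $ k \<le> E" by (simp_all add: E_def)
    then have "1 \<le> E * X $ k $ i" "1 \<le> E * s $ k"
      using X(3) s_pos[of k] by (simp_all add: divide_le_eq)
    with X show "\<exists>E X i. one_step 1 X \<and> i \<in> K \<and> 1 \<le> E * X $ k $ i \<and> 1 \<le> E * s $ k" by blast
  next
    fix k and C D :: real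
    assume *: "\<exists>X i. one_step 1 X \<and> i \<in> K \<and> 1 \<le> C * X $ k $ i \<and> 1 \<le> C * s $ k" and "C \<le> D"
    have "C * X $ k $ i \<le> D * X $ k $ i" if "one_step l X" for l X i
      using \<open>C \<le> D\<close> by (intro mult_right_mono one_step_nonneg[OF that])
    moreover have "C * s $ k \<le> D * s $ k"
      using \<open>C \<le> D\<close> s_pos[of k] by (intro mult_right_mono) auto
    ultimately show "\<exists>X i. one_step 1 X \<and> i \<in> K \<and> 1 \<le> D * X $ k $ i \<and> 1 \<le> D * s $ k"
      using * by (meson order_trans)
  qed simp
  then obtain E where E: "E \<ge> 1"
    "\<And>k. k \<in> K \<Longrightarrow> \<exists>X i. one_step 1 X \<and> i \<in> K \<and> 1 \<le> E * X $ k $ i \<and> 1 \<le> E * s $ k" by blast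
  have "\<exists>v\<in>A n. 1 \<le> E ^ n * v $ k" if "n \<ge> 1" "k \<in> K" for n k
    using that
  proof (induction n arbitrary: k rule: nat_induct_at_least)
    case base
    then show ?case using E(2) by (auto simp: A_1)
  next
    case (Suc n)
    obtain X i where X: "one_step 1 X" "i \<in> K" "1 \<le> E * X $ k $ i" using E(2)[OF Suc.prems] by blast
    obtain v where v: "v \<in> A n" "1 \<le> E ^ n * v $ i" using Suc.IH[OF X(2)] by blast
    have "1 * 1 \<le> (E * X $ k $ i) * (E ^ n * v $ i)"
      using X(3) v(2) by (intro mult_mono) auto
    also have "\<dots> = E ^ Suc n * (X $ k $ i * v $ i)" by simp
    also have "\<dots> \<le> E ^ Suc n * (X *v v) $ k"
      using E(1) by (intro mult_left_mono apply_entry_ge[OF one_step_hole[OF X(1)] v(1)]) auto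
    finally show ?case using one_step_apply[OF X(1) v(1)] by auto
  qed
  then show thesis using that E(1) by blast
qed

lemma K_connection:
  obtains D where "D \<ge> 1" "\<And>k a. k \<in> K \<Longrightarrow> a \<in> K \<Longrightarrow> \<exists>q N. real q \<le> D \<and> one_hole q N \<and> 1 \<le> D * N $ k $ a"
proof -
  have "\<exists>D\<ge>1. \<forall>(k, a) \<in> K \<times> K. \<exists>q N. real q \<le> D \<and> one_hole q N \<and> 1 \<le> D * N $ k $ a"
  proof (rule finite_uniform_bound)
    fix ka assume "ka \<in> K \<times> K"
    then have "reach (fst ka) (snd ka)" by (auto intro: K_reach)
    then obtain q N where N: "one_hole q N" "N $ fst ka $ snd ka > 0"
      unfolding reach_def by blast
    define D where "D = max (real q) (1 / N $ fst ka $ snd ka)"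
    have "1 / N $ fst ka $ snd ka \<le> D" by (simp add: D_def)
    then have "1 \<le> D * N $ fst ka $ snd ka"
      using N(2) by (simp add: divide_le_eq)
    moreover have "real q \<le> D" by (simp add: D_def)
    ultimately show "\<exists>D. case ka of (k, a) \<Rightarrow> \<exists>q N. real q \<le> D \<and> one_hole q N \<and> 1 \<le> D * N $ k $ a"
      using N(1) by (auto simp: split_beta)
  next
    fix ka and C D :: real
    assume *: "case ka of (k, a) \<Rightarrow> \<exists>q N. real q \<le> C \<and> one_hole q N \<and> 1 \<le> C * N $ k $ a" and "C \<le> D"
    have "C * N $ k $ a \<le> D * N $ k $ a" if "one_hole q N" for q N k a
      using \<open>C \<le> D\<close> by (intro mult_right_mono one_hole_nonneg[OF that])
    then show "case ka of (k, a) \<Rightarrow> \<exists>q N. real q \<le> D \<and> one_hole q N \<and> 1 \<le> D * N $ k $ a"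
      using * \<open>C \<le> D\<close> by (auto simp: split_beta) (meson order_trans)
  qed simp
  then obtain D where D: "D \<ge> 1"
    "\<forall>(k, a) \<in> K \<times> K. \<exists>q N. real q \<le> D \<and> one_hole q N \<and> 1 \<le> D * N $ k $ a" by blast
  show thesis by (rule that[OF D(1)]) (use D(2) in blast)
qed

text \<open>
  The greedy construction: a piece of size \<open>m \<ge> n / 16\<close> on top loses a factor \<open>\<gamma>\<close>, and
  \<open>n' \<le> (15 / 16) * n\<close> leaves remain, so any \<open>r\<close> with \<open>(16 / 15) ^ r * \<gamma> \<ge> 1\<close> pays for it.
\<close>
lemma K_entries_ge:
  "\<exists>B>0. \<exists>r::nat. \<forall>n\<ge>1. \<forall>k\<in>K. \<exists>v\<in>A n. B * lam ^ n \<le> v $ k * real n ^ r"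
proof -
  obtain \<epsilon> \<tau>0 where eps: "\<epsilon> > 0" and tau0: "\<tau>0 \<ge> 1" and
    piece: "\<And>\<tau>. \<tau> \<ge> \<tau>0 \<Longrightarrow> \<exists>m M i j. \<tau> \<le> m \<and> m \<le> 8 * \<tau> \<and> one_hole m M \<and> i \<in> K \<and> j \<in> K
      \<and> \<epsilon> * lam ^ m \<le> M $ i $ j"
    using large_pieces by blast
  obtain E where E: "E \<ge> 1" "\<And>n k. n \<ge> 1 \<Longrightarrow> k \<in> K \<Longrightarrow> \<exists>v\<in>A n. 1 \<le> E ^ n * v $ k"
    by (rule crude_lower_bound) blast
  obtain D where D: "D \<ge> 1" "\<And>k a. k \<in> K \<Longrightarrow> a \<in> K \<Longrightarrow> \<exists>q N. real q \<le> D \<and> one_hole q N \<and> 1 \<le> D * N $ k $ a"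
    by (rule K_connection) blast
  define Q where "Q = nat \<lceil>D\<rceil>"
  define lam1 where "lam1 = max 1 lam"
  have lam1: "lam1 \<ge> 1" "lam \<le> lam1" by (auto simp: lam1_def)
  define \<gamma> where "\<gamma> = \<epsilon> / (D * lam1 ^ Q)"
  have gamma: "\<gamma> > 0" using eps D(1) lam1 by (simp add: \<gamma>_def)
  obtain r where r: "1 / \<gamma> < (16 / 15) ^ r" using real_arch_pow[of "16 / 15" "1 / \<gamma>"] by auto
  define n1 where "n1 = 8 * \<tau>0 + 2 * (Q + 8)"
  define B where "B = 1 / (E * lam1) ^ n1"
  have B: "B > 0" using E(1) lam1 by (simp add: B_def)
  have "\<exists>v\<in>A n. B * lam ^ n \<le> v $ k * real n ^ r" if "n \<ge> 1" "k \<in> K" for n k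
    using that
  proof (induction n arbitrary: k rule: less_induct)
    case (less n)
    show ?case
    proof (cases "n \<le> n1")
      case True
      obtain v where v: "v \<in> A n" "1 \<le> E ^ n * v $ k" using E(2)[OF less.prems] by blast
      have "B * lam ^ n \<le> B * lam ^ n * (E ^ n * v $ k)"
        using B rate_pos mult_left_mono[OF v(2), of "B * lam ^ n"] by simp
      also have "\<dots> = B * (E * lam) ^ n * v $ k" by (simp add: power_mult_distrib)
      also have "\<dots> \<le> 1 * v $ k"
      proof (intro mult_right_mono A_nonneg[OF v(1)])
        have "(E * lam) ^ n \<le> (E * lam1) ^ n"
          using E(1) rate_pos lam1 by (intro power_mono mult_left_mono) auto
        also have "\<dots> \<le> (E * lam1) ^ n1"
          using True E(1) lam1 mult_mono[of 1 E 1 lam1] by (intro power_increasing) auto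
        finally show "B * (E * lam) ^ n \<le> 1"
          using E(1) lam1 by (simp add: B_def divide_le_eq)
      qed
      also have "\<dots> \<le> v $ k * real n ^ r"
        using less.prems(1) A_nonneg[OF v(1), of k] by (simp add: mult_le_cancel_left1)
      finally show ?thesis using v(1) by blast
    next
      case False
      \<comment> \<open>The largest window that leaves room for a connecting tree and at least one more leaf.\<close>
      define \<tau> where "\<tau> = (n - Q - 1) div 8"
      have tau: "\<tau> \<ge> \<tau>0" "8 * \<tau> + Q + 1 \<le> n" "n \<le> 16 * \<tau>"
      proof -
        obtain t where t: "n = t + Q + 1" "n - Q - 1 = t" 
          using that[of "n - Q - 1"] False by (simp add: n1_def)
        have "8 * \<tau> \<le> t" "t < 8 * \<tau> + 8" unfolding \<tau>_def t(2) by simp_all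
        with t(1) False show "\<tau> \<ge> \<tau>0" "8 * \<tau> + Q + 1 \<le> n" "n \<le> 16 * \<tau>"
          by (simp_all add: n1_def)
      qed
      obtain m M a b where M: "\<tau> \<le> m" "m \<le> 8 * \<tau>" "one_hole m M" "a \<in> K" "b \<in> K"
          "\<epsilon> * lam ^ m \<le> M $ a $ b"
        using piece[OF tau(1)] by blast
      obtain q N where N: "real q \<le> D" "one_hole q N" "1 \<le> D * N $ k $ a"
        using D(2)[OF less.prems(2) M(4)] by blast
      have q: "q \<le> Q" using N(1) unfolding Q_def by linarith
      define n' where "n' = n - m - q"
      have n': "n' \<ge> 1" "n' < n" "q + (m + n') = n" "16 * n' \<le> 15 * n"
        using tau M(1,2) q tau0 unfolding n'_def by linarith+
      obtain v where v: "v \<in> A n'" "B * lam ^ n' \<le> v $ b * real n' ^ r"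
        using less.IH[OF n'(2,1) M(5)] by blast
      define w where "w = N *v (M *v v)"
      have Mv: "M *v v \<in> A (m + n')" by (rule one_hole_apply[OF M(3) v(1)])
      have w: "w \<in> A n" using one_hole_apply[OF N(2) Mv] n'(3) by (simp add: w_def)
      have "\<epsilon> * lam ^ m * v $ b \<le> M $ a $ b * v $ b"
        using M(6) A_nonneg[OF v(1)] by (rule mult_right_mono)
      also have "\<dots> \<le> (M *v v) $ a" by (rule apply_entry_ge[OF M(3) v(1)])
      also have "\<dots> \<le> (D * N $ k $ a) * (M *v v) $ a"
        using N(3) A_nonneg[OF Mv, of a] mult_right_mono[of 1] by fastforce
      also have "\<dots> = D * (N $ k $ a * (M *v v) $ a)" by simp
      also have "\<dots> \<le> D * w $ k"
        unfolding w_def using D(1) by (intro mult_left_mono apply_entry_ge[OF N(2) Mv]) auto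
      finally have wk: "\<epsilon> * lam ^ m * v $ b \<le> D * w $ k" .

      have lam_n: "lam ^ n \<le> lam1 ^ Q * (lam ^ m * lam ^ n')"
      proof -
        have "lam ^ q \<le> lam1 ^ q" using rate_pos lam1 by (intro power_mono) auto
        also have "\<dots> \<le> lam1 ^ Q" using q lam1 by (intro power_increasing) auto
        finally have "lam ^ q * (lam ^ m * lam ^ n') \<le> lam1 ^ Q * (lam ^ m * lam ^ n')"
          using rate_pos by (intro mult_right_mono) auto
        then show ?thesis using n'(3) by (simp flip: power_add)
      qed
      have n'_pow: "(16 / 15) ^ r * real n' ^ r \<le> real n ^ r"
        using n'(4) by (simp flip: power_mult_distrib add: power_mono)

      have "B * lam ^ n \<le> B * (lam1 ^ Q * (lam ^ m * lam ^ n'))"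
        using B by (intro mult_left_mono lam_n) auto
      also have "\<dots> = 1 * (lam1 ^ Q * lam ^ m * (B * lam ^ n'))" by simp
      also have "\<dots> \<le> (\<gamma> * (16 / 15) ^ r) * (lam1 ^ Q * lam ^ m * (B * lam ^ n'))"
        using r gamma B lam1 rate_pos by (intro mult_right_mono) (auto simp: field_simps)
      also have "\<dots> \<le> (\<gamma> * (16 / 15) ^ r) * (lam1 ^ Q * lam ^ m * (v $ b * real n' ^ r))"
        using gamma lam1 rate_pos by (intro mult_left_mono v(2)) auto
      also have "\<dots> = (\<gamma> * lam1 ^ Q * lam ^ m * v $ b) * ((16 / 15) ^ r * real n' ^ r)" by simp
      also have "\<dots> \<le> (\<gamma> * lam1 ^ Q * lam ^ m * v $ b) * real n ^ r"
        using gamma lam1 rate_pos A_nonneg[OF v(1)] by (intro mult_left_mono n'_pow) auto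
      also have "\<gamma> * lam1 ^ Q * lam ^ m * v $ b = (\<epsilon> * lam ^ m * v $ b) / D"
        using lam1 by (simp add: \<gamma>_def)
      also have "(\<epsilon> * lam ^ m * v $ b) / D * real n ^ r \<le> w $ k * real n ^ r"
        using wk D(1) by (intro mult_right_mono) (auto simp: divide_le_eq mult.commute)
      finally show ?thesis using w by blast
    qed
  qed
  with B show ?thesis by blast
qed

end

lemma (in nonneg_bilinear_rate) growth_lower_bound:
  "\<exists>B>0. \<exists>r::nat. \<forall>n\<ge>1. B * lam ^ n \<le> growth f s n * real n ^ r"
proof -
  obtain k0 where "critical k0" "\<And>j i. reach k0 j \<Longrightarrow> \<not> reach j k0 \<Longrightarrow> reach j i \<Longrightarrow> \<not> critical i"
    by (rule minimal_critical) blast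
  then interpret critical_class s c f lam k0 by unfold_locales
  obtain B r where B: "B > 0" "\<And>n k. n \<ge> 1 \<Longrightarrow> k \<in> K \<Longrightarrow> \<exists>v\<in>A n. B * lam ^ n \<le> v $ k * real n ^ r"
    using K_entries_ge by blast
  have "B * lam ^ n \<le> growth f s n * real n ^ r" if n: "n \<ge> 1" for n
  proof -
    obtain v where v: "v \<in> A n" "B * lam ^ n \<le> v $ k0 * real n ^ r" using B(2)[OF n k0_in_K] by blast
    note v(2)
    also have "v $ k0 * real n ^ r \<le> growth f s n * real n ^ r"
      by (intro mult_right_mono A_le_growth[OF v(1)]) simp
    finally show ?thesis .
  qed
  with B(1) show ?thesis by blast
qed

theorem theorem1:
  fixes s :: "real^'d"
    and c :: "'d \<Rightarrow> 'd \<Rightarrow> 'd \<Rightarrow> real"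
    and f :: "real^'d \<Rightarrow> real^'d \<Rightarrow> real^'d"
    and lam :: real
  assumes s_pos: "\<And>i. s $ i > 0"
    and f_bilinear: "\<And>x y k. f x y $ k = (\<Sum>i\<in>UNIV. \<Sum>j\<in>UNIV. c k i j * x $ i * y $ j)"
    and c_nonneg: "\<And>k i j. c k i j \<ge> 0"
    and growth_rate: "(\<lambda>n. root n (growth f s n)) \<longlonglongrightarrow> lam"
    and rate_pos: "lam > 0"
  shows "\<exists>r r' a a' :: real. r \<ge> 0 \<and> r' \<ge> 0 \<and> a > 0 \<and> a' > 0 \<and>
           (\<forall>n::nat. n \<ge> 1 \<longrightarrow>
              a * real n powr (- r) * lam ^ n \<le> growth f s n \<and>
              growth f s n \<le> a' * real n powr r' * lam ^ n)"
proof -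
  interpret nonneg_bilinear_rate s c f lam
    by unfold_locales (fact s_pos f_bilinear c_nonneg growth_rate rate_pos)+
  obtain N :: nat where N: "\<And>n. n \<ge> 1 \<Longrightarrow> growth f s n \<le> real N * real n ^ N * lam ^ n"
    using growth_upper_bound by blast
  obtain B and r :: nat where B: "B > 0" "\<And>n. n \<ge> 1 \<Longrightarrow> B * lam ^ n \<le> growth f s n * real n ^ r"
    using growth_lower_bound by blast
  have "B * real n powr (- real r) * lam ^ n \<le> growth f s n" if "n \<ge> 1" for n
    using B(2)[OF that] that by (simp add: powr_minus powr_realpow field_simps)
  moreover have "growth f s n \<le> (real N + 1) * real n powr real N * lam ^ n" if "n \<ge> 1" for n
  proof -
    have "growth f s n \<le> real N * real n ^ N * lam ^ n" by (rule N[OF that])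
    also have "\<dots> \<le> (real N + 1) * real n ^ N * lam ^ n"
      using rate_pos by (intro mult_right_mono) auto
    finally show ?thesis using that by (simp add: powr_realpow)
  qed
  ultimately show ?thesis
    using B(1)
    by (intro exI[of _ "real r"] exI[of _ "real N"] exI[of _ B] exI[of _ "real N + 1"]) auto
qed

end
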